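(* Let $A,B,C$ be finite sets, $\theta=\{1,\dots,T\}$, and let $\mathfrak{W}=\{(W_t,V_t):t\in\theta\}$ be a compound wiretap channel with $W_t:A\to\mathcal{P}(B)$ and $V_t:A\to\mathcal{P}(C)$. The secrecy capacity $C_S(\mathfrak{W})$ of $\mathfrak{W}$ without channel state information satisfies $$C_S(\mathfrak{W})\ \ge\ \max_{p\in\mathcal{P}(A)}\Big(\min_{t\in\theta}I(p,W_t)-\max_{t\in\theta}I(p,V_t)\Big).$$
   Context: $\mathcal{P}(B)$ is the set of probability distributions on the finite set $B$; a channel $W:A\to\mathcal{P}(B)$ is a stochastic matrix; $W^{\otimes n}$ is its $n$-th memoryless extension. $I(p,W)$ is the mutual information between input and output of channel $W$ when the input has distribution $p$. Logarithms are to base 2. Compound wiretap channel: a finite family $\mathfrak{W}=\{(W_t,V_t):t\in\theta\}$, $\theta=\{1,\dots,T\}$, with $W_t:A\to\mathcal{P}(B)$ (to the legitimate receiver) and $V_t:A\to\mathcal{P}(C)$ (to the eavesdropper). An $(n,J_n)$ code (no CSI) consists of a stochastic encoder $E:\mathcal{J}_n\to\mathcal{P}(A^n)$, $\mathcal{J}_n=\{1,\dots,J_n\}$, and mutually disjoint decoding sets $\{D_j\subset B^n:j\in\mathcal{J}_n\}$ (neither depends on $t$). Its maximum error probability is $$e(\mathcal{C}_n)=\max_{t\in\theta}\max_{j\in\mathcal{J}_n}\sum_{x^n\in A^n}E(x^n|j)W_t^{\otimes n}(D_j^c|x^n).$$ A number $R\ge 0$ is an achievable secrecy rate without CSI if there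 is a sequence of $(n,J_n)$ codes $\mathcal{C}_n$ with $\lim_n e(\mathcal{C}_n)=0$, $\liminf_n\frac1n\log J_n\ge R$, and $\lim_n\max_{t\in\theta}I(J;Z_t^n)=0$, where $J$ is uniformly distributed on $\mathcal{J}_n$ and $Z_t^n$ is the resulting output of $V_t^{\otimes n}$, i.e. $\Pr(J=j,Z_t^n=z^n)=\frac1{J_n}\sum_{x^n}E(x^n|j)V_t^{\otimes n}(z^n|x^n)$. $C_S(\mathfrak{W})$ is the largest (supremum) achievable secrecy rate without CSI. *)

theory Defs
  imports "HOL-Probability.Probability"
begin

section \<open>Channels\<close>

text \<open>
  Alphabets are types. A channel is a Markov kernel \<open>'a \<Rightarrow> 'b pmf\<close>; on finite alphabets
  this is a stochastic matrix. The words of length \<open>n\<close> are the lists of length \<open>n\<close>.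
\<close>

abbreviation words :: "nat \<Rightarrow> 'a list set" where
  "words n \<equiv> {xs. length xs = n}"

text \<open>The letters of the output word are independent, the \<open>i\<close>-th one with distribution
  \<open>W (xs ! i)\<close>; all the extensions \<open>W\<^sup>\<otimes>\<^sup>n\<close> are combined into one kernel, with \<open>n\<close> the
  length of the input word (see \<open>pmf_memoryless\<close>).\<close>

primrec memoryless :: "('a \<Rightarrow> 'b pmf) \<Rightarrow> 'a list \<Rightarrow> 'b list pmf" where
  "memoryless W [] = return_pmf []"
| "memoryless W (x # xs) = map_pmf (\<lambda>(y, ys). y # ys) (pair_pmf (W x) (memoryless W xs))"

lemma pmf_memoryless:
  "pmf (memoryless W xs) ys =
     (if length ys = length xs then \<Prod>i<length xs. pmf (W (xs ! i)) (ys ! i) else 0)"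
proof (induction xs arbitrary: ys)
  case Nil
  then show ?case by (auto simp: pmf_return)
next
  case (Cons x xs)
  show ?case
  proof (cases ys)
    case Nil
    have "[] \<notin> set_pmf (memoryless W (x # xs))" by auto
    with Nil show ?thesis by (simp add: pmf_eq_0_set_pmf)
  next
    case (Cons z zs)
    have inj: "inj (\<lambda>(y, ys). y # ys)" by (auto simp: inj_def)
    have "pmf (memoryless W (x # xs)) ys =
        pmf (map_pmf (\<lambda>(y, ys). y # ys) (pair_pmf (W x) (memoryless W xs)))
          ((\<lambda>(y, ys). y # ys) (z, zs))"
      using Cons by simp
    also have "\<dots> = pmf (W x) z * pmf (memoryless W xs) zs"
      by (subst pmf_map_inj'[OF inj]) (simp add: pmf_pair)
    finally show ?thesis
      using Cons Cons.IH[of zs] by (simp add: prod.lessThan_Suc_shift del: prod.lessThan_Suc)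
  qed
qed


section \<open>Mutual information\<close>

definition joint :: "'a pmf \<Rightarrow> ('a \<Rightarrow> 'b pmf) \<Rightarrow> ('a \<times> 'b) pmf" where
  "joint p W = bind_pmf p (\<lambda>x. map_pmf (Pair x) (W x))"

text \<open>Measured in bits. The types have to be countable because only then the product of the
  discrete \<open>\<sigma>\<close>-algebras is discrete.\<close>

definition mutual_info :: "'a::countable pmf \<Rightarrow> ('a \<Rightarrow> 'b::countable pmf) \<Rightarrow> real" where
  "mutual_info p W =
     prob_space.mutual_information (measure_pmf (joint p W)) 2
       (count_space UNIV) (count_space UNIV) fst snd"

lemma pmf_joint: "pmf (joint p W) (x, y) = pmf p x * pmf (W x) y"
proof -
  have "pmf (joint p W) (x, y) = measure_pmf.expectation p (\<lambda>x'. pmf (map_pmf (Pair x') (W x')) (x, y))"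
    by (simp add: joint_def pmf_bind)
  also have "\<dots> = measure_pmf.expectation p (\<lambda>x'. indicator {x} x' * pmf (W x) y)"
  proof (rule Bochner_Integration.integral_cong[OF refl])
    fix x'
    show "pmf (map_pmf (Pair x') (W x')) (x, y) = indicator {x} x' * pmf (W x) y"
    proof (cases "x' = x")
      case True
      have "inj (Pair x)" by (auto simp: inj_def)
      from pmf_map_inj'[OF this, of "W x" y] True show ?thesis by simp
    next
      case False
      then show ?thesis by (auto simp: pmf_eq_0_set_pmf)
    qed
  qed
  also have "\<dots> = pmf p x * pmf (W x) y"
    by (simp add: measure_pmf_single)
  finally show ?thesis .
qed

lemma fst_joint: "map_pmf fst (joint p W) = p"
  by (simp add: joint_def map_bind_pmf pmf.map_comp o_def map_pmf_const bind_return_pmf')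

lemma snd_joint: "map_pmf snd (joint p W) = bind_pmf p W"
  by (simp add: joint_def map_bind_pmf pmf.map_comp o_def)

lemma mutual_info_eq_sum:
  assumes "finite (set_pmf p)" and "\<And>x. x \<in> set_pmf p \<Longrightarrow> finite (set_pmf (W x))"
  shows "mutual_info p W =
    (\<Sum>x\<in>set_pmf p. \<Sum>y\<in>set_pmf (W x).
       pmf p x * pmf (W x) y * log 2 (pmf (W x) y / pmf (bind_pmf p W) y))"
proof -
  let ?M = "measure_pmf (joint p W)"
  interpret information_space ?M 2
    by unfold_locales simp_all
  have dist: "distributed ?M (count_space UNIV) f (\<lambda>z. pmf (map_pmf f (joint p W)) z)"
    for f :: "'a \<times> 'b \<Rightarrow> 'z"
  proof -
    have "distr ?M (count_space UNIV) f = measure_pmf (map_pmf f (joint p W))"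
      by (simp add: map_pmf_rep_eq)
    also have "\<dots> = density (count_space UNIV) (\<lambda>z. ennreal (pmf (map_pmf f (joint p W)) z))"
      by (rule measure_pmf_eq_density)
    finally show ?thesis by (simp add: distributed_def)
  qed
  have sf: "sigma_finite_measure (count_space (UNIV :: 'z::countable set))"
    by (intro sigma_finite_measure_count_space_countable) simp
  have cs: "count_space (UNIV :: 'a set) \<Otimes>\<^sub>M count_space (UNIV :: 'b set) = count_space UNIV"
    by (subst pair_measure_countable) auto
  have "mutual_info p W = (\<integral>z. pmf (joint p W) z *
      log 2 (pmf (joint p W) z / (pmf p (fst z) * pmf (bind_pmf p W) (snd z)))
      \<partial>(count_space UNIV \<Otimes>\<^sub>M count_space UNIV))"
    unfolding mutual_info_def
  proof (rule mutual_information_distr[where Px = "pmf p" and Py = "pmf (bind_pmf p W)"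
        and Pxy = "pmf (joint p W)"])
    show "distributed ?M (count_space UNIV) fst (\<lambda>z. pmf p z)"
      using dist[of fst] by (simp add: fst_joint)
    show "distributed ?M (count_space UNIV) snd (\<lambda>z. pmf (bind_pmf p W) z)"
      using dist[of snd] by (simp add: snd_joint)
    show "distributed ?M (count_space UNIV \<Otimes>\<^sub>M count_space UNIV) (\<lambda>z. (fst z, snd z))
        (\<lambda>z. pmf (joint p W) z)"
      using dist[of "\<lambda>z. z"] by (simp add: cs)
  qed (auto simp: sf split: prod.splits)
  also have "\<dots> = (\<integral>z. (case z of (x, y) \<Rightarrow> pmf (joint p W) (x, y) *
      log 2 (pmf (joint p W) (x, y) / (pmf p x * pmf (bind_pmf p W) y))) \<partial>count_space UNIV)"
    by (simp add: cs case_prod_beta)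
  also have "\<dots> = (\<Sum>z\<in>(SIGMA x:set_pmf p. set_pmf (W x)). (case z of (x, y) \<Rightarrow> pmf (joint p W) (x, y) *
      log 2 (pmf (joint p W) (x, y) / (pmf p x * pmf (bind_pmf p W) y))))"
  proof -
    have fin: "finite (SIGMA x:set_pmf p. set_pmf (W x))"
      using assms by auto
    show ?thesis
      by (subst lebesgue_integral_count_space_finite_support)
         (auto intro!: finite_subset[OF _ fin] sum.mono_neutral_cong_left[OF fin]
           simp: pmf_joint pmf_eq_0_set_pmf)
  qed
  also have "\<dots> = (\<Sum>x\<in>set_pmf p. \<Sum>y\<in>set_pmf (W x). pmf (joint p W) (x, y) *
      log 2 (pmf (joint p W) (x, y) / (pmf p x * pmf (bind_pmf p W) y)))"
    using assms by (subst sum.Sigma) auto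
  also have "\<dots> = (\<Sum>x\<in>set_pmf p. \<Sum>y\<in>set_pmf (W x).
       pmf p x * pmf (W x) y * log 2 (pmf (W x) y / pmf (bind_pmf p W) y))"
    by (intro sum.cong refl) (auto simp: pmf_joint set_pmf_iff)
  finally show ?thesis .
qed


section \<open>Compound wiretap channels\<close>

text \<open>
  A compound wiretap channel with states \<open>{1..T}\<close> is a pair of families of channels
  \<open>W t :: 'a \<Rightarrow> 'b pmf\<close> (legitimate receiver) and \<open>V t :: 'a \<Rightarrow> 'c pmf\<close> (eavesdropper).
  A code of length \<open>n\<close> with \<open>J\<close> messages is given by its encoder \<open>E\<close> and its decoding
  sets \<open>D\<close>; values outside \<open>{1..J}\<close> are irrelevant.
\<close>

definition is_code ::
    "nat \<Rightarrow> nat \<Rightarrow> (nat \<Rightarrow> 'a list pmf) \<Rightarrow> (nat \<Rightarrow> 'b list set) \<Rightarrow> bool" where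
  "is_code n J E D \<longleftrightarrow>
     J \<ge> 1 \<and>
     (\<forall>j\<in>{1..J}. set_pmf (E j) \<subseteq> words n) \<and>
     (\<forall>j\<in>{1..J}. D j \<subseteq> words n) \<and>
     disjoint_family_on D {1..J}"

definition max_error ::
    "nat \<Rightarrow> (nat \<Rightarrow> 'a::finite \<Rightarrow> 'b pmf) \<Rightarrow>
     nat \<Rightarrow> nat \<Rightarrow> (nat \<Rightarrow> 'a list pmf) \<Rightarrow> (nat \<Rightarrow> 'b list set) \<Rightarrow> real" where
  "max_error T W n J E D =
     (MAX t\<in>{1..T}. MAX j\<in>{1..J}.
        \<Sum>x\<in>words n. pmf (E j) x * measure_pmf.prob (memoryless (W t) x) (words n - D j))"

text \<open>The kernel from messages to eavesdropper outputs is the encoder followed by the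
  memoryless channel.\<close>

definition max_leakage ::
    "nat \<Rightarrow> (nat \<Rightarrow> 'a \<Rightarrow> 'c::countable pmf) \<Rightarrow> nat \<Rightarrow> (nat \<Rightarrow> 'a list pmf) \<Rightarrow> real" where
  "max_leakage T V J E =
     (MAX t\<in>{1..T}.
        mutual_info (pmf_of_set {1..J}) (\<lambda>j. bind_pmf (E j) (memoryless (V t))))"

definition achievable_secrecy_rate ::
    "nat \<Rightarrow> (nat \<Rightarrow> 'a::finite \<Rightarrow> 'b pmf) \<Rightarrow> (nat \<Rightarrow> 'a \<Rightarrow> 'c::countable pmf) \<Rightarrow> real \<Rightarrow> bool"
  where
  "achievable_secrecy_rate T W V R \<longleftrightarrow>
     R \<ge> 0 \<and>
     (\<exists>J E D.
        (\<forall>n\<ge>1. is_code n (J n) (E n) (D n)) \<and>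
        (\<lambda>n. max_error T W n (J n) (E n) (D n)) \<longlonglongrightarrow> 0 \<and>
        liminf (\<lambda>n. ereal (log 2 (real (J n)) / real n)) \<ge> ereal R \<and>
        (\<lambda>n. max_leakage T V (J n) (E n)) \<longlonglongrightarrow> 0)"

text \<open>Taken in the extended reals, so that the supremum needs no boundedness proof to be
  meaningful.\<close>

definition secrecy_capacity ::
    "nat \<Rightarrow> (nat \<Rightarrow> 'a::finite \<Rightarrow> 'b pmf) \<Rightarrow> (nat \<Rightarrow> 'a \<Rightarrow> 'c::countable pmf) \<Rightarrow> ereal" where
  "secrecy_capacity T W V = (SUP R\<in>{R. achievable_secrecy_rate T W V R}. ereal R)"

definition rate_difference ::
    "nat \<Rightarrow> (nat \<Rightarrow> 'a::countable \<Rightarrow> 'b::countable pmf) \<Rightarrow> (nat \<Rightarrow> 'a \<Rightarrow> 'c::countable pmf) \<Rightarrow>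
     'a pmf \<Rightarrow> real" where
  "rate_difference T W V p =
     (MIN t\<in>{1..T}. mutual_info p (W t)) - (MAX t\<in>{1..T}. mutual_info p (V t))"

end

theory Submission
  imports Defs "HOL-Real_Asymp.Real_Asymp"
begin

text \<open>
  Random coding without typicality. Fix \<open>p\<close> and draw codewords \<open>c (j, l)\<close>, pairwise
  independent with distribution \<open>p\<^sup>n\<close>; message \<open>j\<close> is sent as \<open>c (j, l)\<close> with \<open>l\<close> uniform.
  The receiver looks for codewords whose likelihood ratio \<open>W\<^sub>t\<^sup>n(y|x) / Q\<^sub>t\<^sup>n(y)\<close> exceeds a threshold
  \<open>\<theta>\<close> for at least one state \<open>t\<close>. For fixed \<open>y\<close> this ratio has mean at most \<open>1\<close> over a random
  codeword, so by Markov's inequality a wrong codeword passes with probability at most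
  \<open>T / \<theta>\<close>, whatever the true state is; the right one fails with exponentially small
  probability if \<open>\<theta> = 2\<^sup>n\<^sup>m\<close> with \<open>m\<close> below all \<open>I(p, W\<^sub>t)\<close>. The expected divergence of the
  eavesdropper's output given \<open>j\<close> from \<open>Q\<^sub>t\<^sup>n\<close> is at most the mean of \<open>log (1 + ratio / L)\<close>,
  which decays exponentially once the number \<open>L\<close> of values of \<open>l\<close> has rate above all
  \<open>I(p, V\<^sub>t)\<close>. Keeping the better half of the messages turns the average bounds into bounds
  for every message, and the leakage is at most the largest of these divergences.
\<close>

section \<open>Expectations over finitely supported distributions\<close>

abbreviation expect :: "'a pmf \<Rightarrow> ('a \<Rightarrow> real) \<Rightarrow> real" where
  "expect p f \<equiv> measure_pmf.expectation p f"

lemma expect_finite: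
  "finite (set_pmf p) \<Longrightarrow> expect p f = (\<Sum>x\<in>set_pmf p. pmf p x * f x)"
  by (subst integral_measure_pmf[of "set_pmf p"]) auto

lemma expect_cong:
  "(\<And>x. x \<in> set_pmf p \<Longrightarrow> f x = g x) \<Longrightarrow> expect p f = expect p g"
  by (intro integral_cong_AE) (auto simp: AE_measure_pmf_iff)

lemma expect_mono:
  "finite (set_pmf p) \<Longrightarrow> (\<And>x. x \<in> set_pmf p \<Longrightarrow> f x \<le> g x) \<Longrightarrow> expect p f \<le> expect p g"
  by (auto simp: expect_finite intro!: sum_mono mult_left_mono)

lemma expect_nonneg:
  "(\<And>x. x \<in> set_pmf p \<Longrightarrow> 0 \<le> f x) \<Longrightarrow> 0 \<le> expect p f"
  by (intro integral_nonneg_AE) (auto simp: AE_measure_pmf_iff)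

lemma expect_sum:
  "finite (set_pmf p) \<Longrightarrow> expect p (\<lambda>x. \<Sum>i\<in>I. f i x) = (\<Sum>i\<in>I. expect p (f i))"
  by (intro Bochner_Integration.integral_sum integrable_measure_pmf_finite)

lemma expect_add:
  "finite (set_pmf p) \<Longrightarrow> expect p (\<lambda>x. f x + g x) = expect p f + expect p g"
  by (intro Bochner_Integration.integral_add integrable_measure_pmf_finite)

lemma expect_diff:
  "finite (set_pmf p) \<Longrightarrow> expect p (\<lambda>x. f x - g x) = expect p f - expect p g"
  by (intro Bochner_Integration.integral_diff integrable_measure_pmf_finite)

lemma expect_bind:
  assumes "finite (set_pmf p)" "\<And>x. x \<in> set_pmf p \<Longrightarrow> finite (set_pmf (f x))"
  shows "expect (bind_pmf p f) h = expect p (\<lambda>x. expect (f x) h)"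
  using assms by (subst pmf_expectation_bind[of "set_pmf p"]) (auto simp: expect_finite)

lemma expect_pair:
  assumes "finite (set_pmf p)" "finite (set_pmf q)"
  shows "expect (pair_pmf p q) h = expect p (\<lambda>x. expect q (\<lambda>y. h (x, y)))"
  using assms by (simp add: pair_pmf_def expect_bind)

lemma expect_swap:
  assumes "finite (set_pmf p)" "finite (set_pmf q)"
  shows "expect p (\<lambda>x. expect q (\<lambda>y. h x y)) = expect q (\<lambda>y. expect p (\<lambda>x. h x y))"
  using assms by (simp add: expect_finite sum_distrib_left mult_ac sum.swap[of _ "set_pmf q"])

text \<open>If every value on the support exceeded \<open>e\<close>, so would the mean. This is the
  step from a random codebook to a fixed one.\<close>

lemma expect_le_exists:
  assumes "finite (set_pmf p)" "expect p f \<le> e"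
  shows "\<exists>x\<in>set_pmf p. f x \<le> e"
proof (rule ccontr)
  assume "\<not> ?thesis"
  then have *: "\<And>x. x \<in> set_pmf p \<Longrightarrow> f x > e" by force
  have "e = (\<Sum>x\<in>set_pmf p. pmf p x * e)"
    using assms by (simp add: sum_distrib_right[symmetric] sum_pmf_eq_1)
  also have "\<dots> < (\<Sum>x\<in>set_pmf p. pmf p x * f x)"
    using assms(1) * by (intro sum_strict_mono) (auto simp: set_pmf_not_empty pmf_positive)
  finally show False using assms by (simp add: expect_finite)
qed

lemma prob_eq_expect: "measure_pmf.prob p A = expect p (indicator A)"
  by simp

lemma finite_set_joint:
  "finite (set_pmf p) \<Longrightarrow> (\<And>x. x \<in> set_pmf p \<Longrightarrow> finite (set_pmf (W x))) \<Longrightarrow> finite (set_pmf (joint p W))"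
  by (auto simp: joint_def)

lemma expect_joint:
  assumes "finite (set_pmf p)" "\<And>x. x \<in> set_pmf p \<Longrightarrow> finite (set_pmf (W x))"
  shows "expect (joint p W) h = expect p (\<lambda>x. expect (W x) (\<lambda>y. h (x, y)))"
  using assms by (simp add: joint_def expect_bind)

lemma prob_joint:
  assumes "finite (set_pmf p)" "\<And>x. x \<in> set_pmf p \<Longrightarrow> finite (set_pmf (W x))"
  shows "measure_pmf.prob (joint p W) A = expect p (\<lambda>x. measure_pmf.prob (W x) (Pair x -` A))"
proof -
  have "indicator A (x, y) = (indicator (Pair x -` A) y :: real)" for x y
    by (simp add: indicator_def)
  then show ?thesis
    unfolding prob_eq_expect by (simp only: expect_joint[OF assms])
qed

lemma set_joint: "set_pmf (joint p W) = (SIGMA x:set_pmf p. set_pmf (W x))"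
  by (auto simp: joint_def)

text \<open>At \<open>s = 0\<close> both sides are \<open>1\<close>, and there the right hand side has the larger
  derivative.\<close>

lemma exp_moment_bound:
  fixes X :: "'a \<Rightarrow> real"
  assumes fin: "finite (set_pmf p)" and m: "expect p X < m"
  shows "\<exists>s. 0 < s \<and> s \<le> 1 \<and> expect p (\<lambda>x. 2 powr (s * X x)) \<le> 2 powr (s * m)"
proof -
  define f where "f s = (\<Sum>x\<in>set_pmf p. pmf p x * 2 powr (s * X x)) - 2 powr (s * m)" for s :: real
  have "(f has_real_derivative ((\<Sum>x\<in>set_pmf p. pmf p x * (ln 2 * X x)) - ln 2 * m)) (at 0)"
    unfolding f_def by (auto intro!: derivative_eq_intros sum.cong simp: powr_def mult_ac)
  moreover have "(\<Sum>x\<in>set_pmf p. pmf p x * (ln 2 * X x)) - ln 2 * m < 0"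
  proof -
    have "(\<Sum>x\<in>set_pmf p. pmf p x * (ln 2 * X x)) = ln 2 * expect p X"
      using fin by (simp add: expect_finite sum_distrib_left mult_ac)
    with m show ?thesis by simp
  qed
  ultimately obtain d where d: "d > 0" "\<And>h. 0 < h \<Longrightarrow> h < d \<Longrightarrow> f (0 + h) < f 0"
    using DERIV_neg_dec_right by blast
  \<comment> \<open>Any point strictly between 0 and \<open>d\<close> would give the decrease; the
    cap at 1 is there because \<open>log_1_plus_le\<close> asks for
    \<open>s \<le> 1\<close>.\<close>
  define s where "s = min 1 (d / 2)"
  have "f s < f 0" "0 < s" "s \<le> 1" using d(1) d(2)[of s] by (auto simp: s_def)
  moreover have "f 0 = 0" using fin by (simp add: f_def sum_pmf_eq_1)
  ultimately show ?thesis using fin by (intro exI[of _ s]) (auto simp: f_def expect_finite)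
qed

section \<open>Likelihood ratios and divergence\<close>

text \<open>The junk value \<open>z / 0 = 0\<close> is harmless: outputs of probability \<open>0\<close> pass no positive
  threshold.\<close>

definition lr :: "'a pmf \<Rightarrow> ('a \<Rightarrow> 'b pmf) \<Rightarrow> 'a \<Rightarrow> 'b \<Rightarrow> real" where
  "lr p W x y = pmf (W x) y / pmf (bind_pmf p W) y"

text \<open>Relative entropy in bits. Where \<open>q\<close> vanishes but \<open>p\<close> does not,
  the term is a finite default instead of infinity, hence the inclusion of supports assumed in
  \<open>kl_nonneg\<close>.\<close>

definition kl :: "'a pmf \<Rightarrow> 'a pmf \<Rightarrow> real" where
  "kl p q = expect p (\<lambda>x. log 2 (pmf p x / pmf q x))"

lemma lr_nonneg: "0 \<le> lr p W x y"
  by (simp add: lr_def)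

lemma lr_pos: "x \<in> set_pmf p \<Longrightarrow> y \<in> set_pmf (W x) \<Longrightarrow> 0 < lr p W x y"
  unfolding lr_def by (intro divide_pos_pos) (auto simp: pmf_positive_iff)

text \<open>The numerator averages to the denominator, so the mean is 1, or 0 if \<open>y\<close>
  has output probability 0. Both the decoding bound and the leakage bound rest on this.\<close>

lemma expect_lr_le_1:
  assumes "finite (set_pmf p)"
  shows "expect p (\<lambda>x. lr p W x y) \<le> 1"
proof -
  have "expect p (\<lambda>x. lr p W x y) = expect p (\<lambda>x. pmf (W x) y) / pmf (bind_pmf p W) y"
    by (simp add: lr_def)
  also have "expect p (\<lambda>x. pmf (W x) y) = pmf (bind_pmf p W) y"
    by (simp add: pmf_bind)
  finally show ?thesis by simp
qed

lemma mutual_info_eq_expect: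
  assumes "finite (set_pmf p)" and "\<And>x. x \<in> set_pmf p \<Longrightarrow> finite (set_pmf (W x))"
  shows "mutual_info p W = expect (joint p W) (\<lambda>(x, y). log 2 (lr p W x y))"
  using assms
  by (simp add: mutual_info_eq_sum expect_joint expect_finite lr_def sum_distrib_left mult_ac)

text \<open>By concavity the logarithm lies below its tangent at \<open>a\<close>. The choice
  \<open>a = 1\<close> yields \<open>kl_nonneg\<close>; a variable \<open>a\<close> serves the
  random codebook.\<close>

lemma log2_le: "u > 0 \<Longrightarrow> a > 0 \<Longrightarrow> log 2 u \<le> log 2 a + (u - a) / (a * ln 2)"
proof -
  assume "u > 0" "a > 0"
  then have "ln (u / a) \<le> u / a - 1" by (intro ln_le_minus_one) auto
  then have "ln u - ln a \<le> (u - a) / a" using \<open>u > 0\<close> \<open>a > 0\<close> by (simp add: ln_div diff_divide_distrib)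
  then have "(ln u - ln a) / ln 2 \<le> (u - a) / a / ln 2" by (intro divide_right_mono) auto
  moreover have "log 2 u = log 2 a + (ln u - ln a) / ln 2" by (simp add: log_def diff_divide_distrib)
  ultimately show ?thesis by simp
qed

lemma kl_self: "kl p p = 0"
proof -
  have "kl p p = expect p (\<lambda>_. 0)"
    unfolding kl_def by (intro expect_cong) (simp add: set_pmf_iff)
  then show ?thesis by simp
qed

text \<open>Gibbs' inequality: the tangent at 1 bounds \<open>log 2 (q / p)\<close>, and
  \<open>q\<close> has mass at most 1 on the support of \<open>p\<close>.\<close>

lemma kl_nonneg:
  assumes fin: "finite (set_pmf p)" and sub: "set_pmf p \<subseteq> set_pmf q"
  shows "0 \<le> kl p q"
proof -
  have "(\<Sum>x\<in>set_pmf p. pmf p x) - (\<Sum>x\<in>set_pmf p. pmf q x) \<ge> 0"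
    using fin by (simp add: sum_pmf_eq_1 measure_measure_pmf_finite[symmetric])
  then have "0 \<le> (\<Sum>x\<in>set_pmf p. (pmf p x - pmf q x) / ln 2)"
    by (simp add: sum_divide_distrib[symmetric] sum_subtractf)
  also have "\<dots> \<le> (\<Sum>x\<in>set_pmf p. pmf p x * log 2 (pmf p x / pmf q x))"
  proof (rule sum_mono)
    fix x assume x: "x \<in> set_pmf p"
    then have pos: "0 < pmf p x" "0 < pmf q x" using sub by (auto simp: pmf_positive_iff)
    then have "pmf p x * log 2 (pmf q x / pmf p x) \<le> pmf p x * ((pmf q x / pmf p x - 1) / ln 2)"
      using log2_le[of "pmf q x / pmf p x" 1] by (intro mult_left_mono) auto
    also have "\<dots> = (pmf q x - pmf p x) / ln 2"
      using pos by (simp add: field_simps)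
    finally have "pmf p x * log 2 (pmf q x / pmf p x) \<le> (pmf q x - pmf p x) / ln 2" .
    then show "(pmf p x - pmf q x) / ln 2 \<le> pmf p x * log 2 (pmf p x / pmf q x)"
      using pos by (simp add: log_divide algebra_simps diff_divide_distrib)
  qed
  finally show ?thesis using fin by (simp add: kl_def expect_finite)
qed

lemma mutual_info_eq_kl:
  assumes "finite (set_pmf p)" and "\<And>x. x \<in> set_pmf p \<Longrightarrow> finite (set_pmf (W x))"
  shows "mutual_info p W = expect p (\<lambda>x. kl (W x) (bind_pmf p W))"
  using assms by (simp add: mutual_info_eq_expect expect_joint lr_def kl_def)

lemma mutual_info_nonneg:
  assumes "finite (set_pmf p)" and "\<And>x. x \<in> set_pmf p \<Longrightarrow> finite (set_pmf (W x))"
  shows "0 \<le> mutual_info p W"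
  using assms by (subst mutual_info_eq_kl) (auto intro!: expect_nonneg kl_nonneg)

text \<open>The gap is the divergence between the output distribution and \<open>q\<close>.\<close>

lemma mutual_info_le_kl:
  assumes fin: "finite (set_pmf p)" "\<And>x. x \<in> set_pmf p \<Longrightarrow> finite (set_pmf (W x))"
    and sub: "\<And>x. x \<in> set_pmf p \<Longrightarrow> set_pmf (W x) \<subseteq> set_pmf q"
  shows "mutual_info p W \<le> expect p (\<lambda>x. kl (W x) q)"
proof -
  let ?r = "bind_pmf p W"
  have "kl (W x) q - kl (W x) ?r = expect (W x) (\<lambda>y. log 2 (pmf ?r y / pmf q y))"
    if x: "x \<in> set_pmf p" for x
  proof -
    have "kl (W x) q - kl (W x) ?r =
      expect (W x) (\<lambda>y. log 2 (pmf (W x) y / pmf q y) - log 2 (pmf (W x) y / pmf ?r y))"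
      using fin(2)[OF x] by (simp add: kl_def expect_diff)
    also have "\<dots> = expect (W x) (\<lambda>y. log 2 (pmf ?r y / pmf q y))"
    proof (rule expect_cong)
      fix y assume y: "y \<in> set_pmf (W x)"
      then have "0 < pmf (W x) y" "0 < pmf q y" "0 < pmf ?r y"
        using x sub[OF x] by (auto simp: pmf_positive_iff)
      then show "log 2 (pmf (W x) y / pmf q y) - log 2 (pmf (W x) y / pmf ?r y) =
          log 2 (pmf ?r y / pmf q y)" by (simp add: log_divide)
    qed
    finally show ?thesis .
  qed
  then have "expect p (\<lambda>x. kl (W x) q) - mutual_info p W = kl ?r q"
    using fin by (simp add: mutual_info_eq_kl kl_def[of ?r] expect_bind expect_diff[symmetric])
      (rule expect_cong, simp)
  moreover have "kl ?r q \<ge> 0" using fin sub by (intro kl_nonneg) auto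
  ultimately show ?thesis by simp
qed

section \<open>Random codebooks\<close>

text \<open>Splitting coordinate \<open>i\<close> off the product leaves \<open>j\<close> in an
  independent factor.\<close>

lemma map_Pi_pmf_pair:
  assumes "finite A" "i \<in> A" "j \<in> A" "i \<noteq> j"
  shows "map_pmf (\<lambda>f. (f i, f j)) (Pi_pmf A d (\<lambda>_. p)) = pair_pmf p p"
proof -
  have A: "A = insert i (A - {i})" using assms by auto
  have "map_pmf (\<lambda>f. (f i, f j)) (Pi_pmf A d (\<lambda>_. p)) =
      map_pmf (\<lambda>(a, f). (a, f j)) (pair_pmf p (Pi_pmf (A - {i}) d (\<lambda>_. p)))"
    using assms by (subst A, subst Pi_pmf_insert) (auto simp: pmf.map_comp o_def case_prod_unfold)
  also have "\<dots> = pair_pmf p p"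
    using assms by (simp add: map_pair[where f = "\<lambda>a. a"] Pi_pmf_component)
  finally show ?thesis .
qed

lemma finite_set_Pi_pmf:
  "finite A \<Longrightarrow> finite (set_pmf p) \<Longrightarrow> finite (set_pmf (Pi_pmf A d (\<lambda>_. p)))"
  by (simp add: set_Pi_pmf finite_PiE_dflt)

lemma expect_Pi_pmf_component:
  assumes "finite A" "i \<in> A"
  shows "expect (Pi_pmf A d (\<lambda>_. p)) (\<lambda>c. f (c i)) = expect p f"
proof -
  have "expect (Pi_pmf A d (\<lambda>_. p)) (\<lambda>c. f (c i)) =
      expect (map_pmf (\<lambda>c. c i) (Pi_pmf A d (\<lambda>_. p))) f" by simp
  then show ?thesis using assms by (simp only: Pi_pmf_component if_True)
qed

lemma expect_Pi_pmf_pair: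
  assumes "finite A" "i \<in> A" "j \<in> A" "i \<noteq> j" "finite (set_pmf p)"
  shows "expect (Pi_pmf A d (\<lambda>_. p)) (\<lambda>c. h (c i) (c j)) = expect p (\<lambda>x. expect p (h x))"
proof -
  have "expect (Pi_pmf A d (\<lambda>_. p)) (\<lambda>c. h (c i) (c j)) =
      expect (map_pmf (\<lambda>c. (c i, c j)) (Pi_pmf A d (\<lambda>_. p))) (\<lambda>z. h (fst z) (snd z))" by simp
  also have "\<dots> = expect (pair_pmf p p) (\<lambda>z. h (fst z) (snd z))"
    by (subst map_Pi_pmf_pair) (use assms in auto)
  finally show ?thesis using assms by (simp add: expect_pair)
qed

lemma expect_uniform:
  "finite I \<Longrightarrow> I \<noteq> {} \<Longrightarrow> expect (map_pmf c (pmf_of_set I)) f = (\<Sum>i\<in>I. f (c i)) / card I"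
  by (simp add: integral_pmf_of_set)

lemma pmf_bind_uniform:
  "finite I \<Longrightarrow> I \<noteq> {} \<Longrightarrow>
    pmf (bind_pmf (map_pmf c (pmf_of_set I)) V) z = (\<Sum>i\<in>I. pmf (V (c i)) z) / card I"
  by (simp add: pmf_bind integral_pmf_of_set)

text \<open>Instead of Jensen's inequality we use the tangent of the logarithm at
  \<open>1 + lr (c i) z / card I\<close>, the conditional mean of the averaged ratio given \<open>c i\<close>
  up to a term that only helps; this needs only pairwise independence of the codewords.\<close>

lemma expect_kl_random_codebook:
  fixes P :: "'x pmf" and V :: "'x \<Rightarrow> 'z pmf"
  assumes P: "finite (set_pmf P)" and V: "\<And>x. x \<in> set_pmf P \<Longrightarrow> finite (set_pmf (V x))"
    and A: "finite A" and I: "I \<subseteq> A" "I \<noteq> {}"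
  shows "expect (Pi_pmf A d (\<lambda>_. P))
      (\<lambda>c. kl (bind_pmf (map_pmf c (pmf_of_set I)) V) (bind_pmf P V))
    \<le> expect (joint P V) (\<lambda>(x, z). log 2 (1 + lr P V x z / card I))"
proof -
  let ?C = "Pi_pmf A d (\<lambda>_. P)" and ?n = "real (card I)"
  have fI: "finite I" using A I finite_subset by blast
  have n: "?n > 0" using fI I by (simp add: card_gt_0_iff)
  have fC: "finite (set_pmf ?C)" using A P by (rule finite_set_Pi_pmf)
  define a where "a x z = 1 + lr P V x z / ?n" for x z
  \<comment> \<open>The tangent at \<open>a\<close> has three parts: its value gives
    \<open>F\<close>, each other codeword contributes \<open>H\<close>, and the constant 1 left
    after cancellation gives \<open>B\<close>. On average the \<open>H\<close> terms do not exceed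
    the \<open>B\<close> term, so only \<open>F\<close> survives.\<close>
  define F where "F x = expect (V x) (\<lambda>z. log 2 (a x z))" for x
  define H where "H x x' = expect (V x) (\<lambda>z. lr P V x' z / (a x z * ln 2))" for x x'
  define B where "B x = expect (V x) (\<lambda>z. 1 / (a x z * ln 2))" for x
  have a: "a x z > 0" for x z unfolding a_def using n lr_nonneg[of P V x z]
    by (intro add_pos_nonneg) auto
  have B_nonneg: "B x \<ge> 0" for x unfolding B_def using a by (intro expect_nonneg) (auto simp: less_imp_le)
  have pointwise: "kl (bind_pmf (map_pmf c (pmf_of_set I)) V) (bind_pmf P V) \<le>
      (\<Sum>i\<in>I. F (c i) + (\<Sum>k\<in>I-{i}. H (c i) (c k)) / ?n - B (c i)) / ?n"
    if c: "\<And>i. i \<in> I \<Longrightarrow> c i \<in> set_pmf P" for c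
  proof -
    let ?K = "bind_pmf (map_pmf c (pmf_of_set I)) V"
    have u: "pmf ?K z / pmf (bind_pmf P V) z = (\<Sum>i\<in>I. lr P V (c i) z) / ?n" for z
      using fI I by (simp add: pmf_bind_uniform lr_def sum_divide_distrib mult.commute)
    have fV: "finite (set_pmf (V (c i)))" if "i \<in> I" for i using V c that by auto
    have "kl ?K (bind_pmf P V) =
        (\<Sum>i\<in>I. expect (V (c i)) (\<lambda>z. log 2 ((\<Sum>k\<in>I. lr P V (c k) z) / ?n))) / ?n"
      unfolding kl_def u using fI I fV by (subst expect_bind) (auto simp: expect_uniform integral_pmf_of_set)
    also have "\<dots> \<le> (\<Sum>i\<in>I. F (c i) + (\<Sum>k\<in>I-{i}. H (c i) (c k)) / ?n - B (c i)) / ?n"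
    proof (intro divide_right_mono sum_mono)
      fix i assume i: "i \<in> I"
      have "expect (V (c i)) (\<lambda>z. log 2 ((\<Sum>k\<in>I. lr P V (c k) z) / ?n)) \<le>
        expect (V (c i)) (\<lambda>z. log 2 (a (c i) z) +
          (\<Sum>k\<in>I-{i}. lr P V (c k) z / (a (c i) z * ln 2)) / ?n - 1 / (a (c i) z * ln 2))"
      proof (rule expect_mono[OF fV[OF i]])
        fix z assume z: "z \<in> set_pmf (V (c i))"
        have split: "(\<Sum>k\<in>I. lr P V (c k) z) = lr P V (c i) z + (\<Sum>k\<in>I-{i}. lr P V (c k) z)"
          using fI i by (simp add: sum.remove)
        \<comment> \<open>The codeword \<open>c i\<close> has positive ratio at its own outputs,
          which makes the tangent bound applicable.\<close>
        have "(\<Sum>k\<in>I. lr P V (c k) z) / ?n > 0"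
          unfolding split using lr_pos[OF c[OF i], of z V] z n
          by (intro divide_pos_pos add_pos_nonneg sum_nonneg lr_nonneg) auto
        from log2_le[OF this a[of "c i" z]]
        have "log 2 ((\<Sum>k\<in>I. lr P V (c k) z) / ?n) \<le> log 2 (a (c i) z) +
            ((\<Sum>k\<in>I. lr P V (c k) z) / ?n - a (c i) z) / (a (c i) z * ln 2)" .
        \<comment> \<open>The ratio of \<open>c i\<close> itself cancels against the one inside
          \<open>a\<close>.\<close>
        also have "(\<Sum>k\<in>I. lr P V (c k) z) / ?n - a (c i) z =
            (\<Sum>k\<in>I-{i}. lr P V (c k) z) / ?n - 1"
          unfolding split a_def by (simp add: add_divide_distrib)
        finally show "log 2 ((\<Sum>k\<in>I. lr P V (c k) z) / ?n) \<le> log 2 (a (c i) z) +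
          (\<Sum>k\<in>I-{i}. lr P V (c k) z / (a (c i) z * ln 2)) / ?n - 1 / (a (c i) z * ln 2)"
          by (simp add: diff_divide_distrib sum_divide_distrib mult_ac)
      qed
      also have "\<dots> = F (c i) + (\<Sum>k\<in>I-{i}. H (c i) (c k)) / ?n - B (c i)"
        using fV[OF i] by (simp add: expect_add expect_diff expect_sum F_def H_def B_def)
      finally show "expect (V (c i)) (\<lambda>z. log 2 ((\<Sum>k\<in>I. lr P V (c k) z) / ?n))
        \<le> F (c i) + (\<Sum>k\<in>I-{i}. H (c i) (c k)) / ?n - B (c i)" .
    qed (use n in auto)
    finally show ?thesis .
  qed
  have EB: "expect P B \<ge> 0" using B_nonneg by (intro expect_nonneg) auto
  \<comment> \<open>Since \<open>c k\<close> is independent of \<open>c i\<close>, averaging over it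
    first replaces its ratio by at most 1, which turns \<open>H\<close> into
    \<open>B\<close>.\<close>
  have H_le: "expect ?C (\<lambda>c. H (c i) (c k)) \<le> expect P B" if "i \<in> I" "k \<in> I - {i}" for i k
  proof -
    have "expect ?C (\<lambda>c. H (c i) (c k)) = expect P (\<lambda>x. expect P (H x))"
      using that A I P by (intro expect_Pi_pmf_pair) auto
    also have "\<dots> \<le> expect P B"
    proof (rule expect_mono[OF P])
      fix x assume x: "x \<in> set_pmf P"
      have "expect P (H x) = expect (V x) (\<lambda>z. expect P (\<lambda>x'. lr P V x' z) / (a x z * ln 2))"
        unfolding H_def[abs_def] using P V[OF x] by (subst expect_swap) auto
      also have "\<dots> \<le> B x"
        unfolding B_def using expect_lr_le_1[OF P] a
        by (intro expect_mono V[OF x] divide_right_mono) (auto simp: less_imp_le)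
      finally show "expect P (H x) \<le> B x" .
    qed
    finally show ?thesis .
  qed
  have "expect ?C (\<lambda>c. kl (bind_pmf (map_pmf c (pmf_of_set I)) V) (bind_pmf P V)) \<le>
    expect ?C (\<lambda>c. (\<Sum>i\<in>I. F (c i) + (\<Sum>k\<in>I-{i}. H (c i) (c k)) / ?n - B (c i)) / ?n)"
  proof (rule expect_mono[OF fC pointwise])
    fix c i assume "c \<in> set_pmf ?C" "i \<in> I"
    then show "c i \<in> set_pmf P" using A I by (auto simp: set_Pi_pmf PiE_dflt_def)
  qed
  also have "\<dots> = (\<Sum>i\<in>I. expect ?C (\<lambda>c. F (c i)) +
      (\<Sum>k\<in>I-{i}. expect ?C (\<lambda>c. H (c i) (c k))) / ?n - expect ?C (\<lambda>c. B (c i))) / ?n"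
    using fC by (simp add: expect_sum expect_add expect_diff)
  also have "\<dots> \<le> (\<Sum>i\<in>I. expect P F) / ?n"
  proof (intro divide_right_mono sum_mono)
    fix i assume i: "i \<in> I"
    have "(\<Sum>k\<in>I-{i}. expect ?C (\<lambda>c. H (c i) (c k))) \<le> (\<Sum>k\<in>I-{i}. expect P B)"
      using i H_le by (intro sum_mono) auto
    also have "\<dots> \<le> ?n * expect P B"
      using EB i fI by (auto intro!: mult_right_mono simp: card_Diff_singleton)
    finally have "(\<Sum>k\<in>I-{i}. expect ?C (\<lambda>c. H (c i) (c k))) / ?n \<le> expect P B"
      using n by (simp add: pos_divide_le_eq mult.commute)
    moreover have "expect ?C (\<lambda>c. F (c i)) = expect P F" "expect ?C (\<lambda>c. B (c i)) = expect P B"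
      using i A I by (auto intro: expect_Pi_pmf_component)
    ultimately show "expect ?C (\<lambda>c. F (c i)) +
      (\<Sum>k\<in>I-{i}. expect ?C (\<lambda>c. H (c i) (c k))) / ?n - expect ?C (\<lambda>c. B (c i)) \<le> expect P F"
      by simp
  qed (use n in auto)
  also have "\<dots> = expect (joint P V) (\<lambda>(x, z). log 2 (1 + lr P V x z / card I))"
    using P V n by (simp add: expect_joint F_def[abs_def] a_def)
  finally show ?thesis .
qed

section \<open>Threshold decoding and its mean error\<close>

definition passes :: "'t set \<Rightarrow> 'x pmf \<Rightarrow> ('t \<Rightarrow> 'x \<Rightarrow> 'y pmf) \<Rightarrow> real \<Rightarrow> 'x \<Rightarrow> 'y \<Rightarrow> bool" where
  "passes \<Theta> P W \<theta> x y \<longleftrightarrow> (\<exists>t\<in>\<Theta>. \<theta> < lr P (W t) x y)"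

text \<open>Here \<open>A\<close> indexes all codewords and \<open>I\<close> those of one message.
  Several codewords of \<open>I\<close> may pass, because the randomization index need not be
  recovered. Disjoint index sets within \<open>A\<close> give disjoint decoding sets.\<close>

definition decoding_set ::
    "('x \<Rightarrow> 'y \<Rightarrow> bool) \<Rightarrow> 'i set \<Rightarrow> 'i set \<Rightarrow> ('i \<Rightarrow> 'x) \<Rightarrow> 'y set" where
  "decoding_set R A I c = {y. (\<exists>i\<in>I. R (c i) y) \<and> (\<forall>i\<in>A - I. \<not> R (c i) y)}"

text \<open>Union bound: an error means that the sent codeword fails the test for the true state
  \<open>t\<close>, or that some codeword of another message passes the test for some state
  \<open>s\<close>. The second event is handled by Markov's inequality for each pair of codeword and
  state.\<close>

lemma expect_error_random_codebook:
  fixes P :: "'x pmf" and W :: "'t \<Rightarrow> 'x \<Rightarrow> 'y pmf"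
  assumes P: "finite (set_pmf P)" and W: "\<And>t x. t \<in> \<Theta> \<Longrightarrow> x \<in> set_pmf P \<Longrightarrow> finite (set_pmf (W t x))"
    and \<Theta>: "finite \<Theta>" "t \<in> \<Theta>" and A: "finite A" and I: "I \<subseteq> A" "I \<noteq> {}" and \<theta>: "\<theta> > 0"
  shows "expect (Pi_pmf A d (\<lambda>_. P)) (\<lambda>c. expect (map_pmf c (pmf_of_set I))
      (\<lambda>x. measure_pmf.prob (W t x) (- decoding_set (passes \<Theta> P W \<theta>) A I c)))
    \<le> measure_pmf.prob (joint P (W t)) {(x, y). lr P (W t) x y \<le> \<theta>} + card A * card \<Theta> / \<theta>"
proof -
  let ?C = "Pi_pmf A d (\<lambda>_. P)" and ?n = "real (card I)"
  have fI: "finite I" using A I finite_subset by blast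
  have n: "?n > 0" using fI I by (simp add: card_gt_0_iff)
  have fC: "finite (set_pmf ?C)" using A P by (rule finite_set_Pi_pmf)
  define G where "G x = measure_pmf.prob (W t x) {y. lr P (W t) x y \<le> \<theta>}" for x
  define H where "H s x x' = measure_pmf.prob (W t x) {y. \<theta> < lr P (W s) x' y}" for s x x'
  have pointwise: "measure_pmf.prob (W t (c i)) (- decoding_set (passes \<Theta> P W \<theta>) A I c) \<le>
      G (c i) + (\<Sum>k\<in>A - I. \<Sum>s\<in>\<Theta>. H s (c i) (c k))" if "i \<in> I" for c i
  proof -
    let ?M = "measure_pmf.prob (W t (c i))"
    have "?M (- decoding_set (passes \<Theta> P W \<theta>) A I c) \<le>
      ?M ({y. lr P (W t) (c i) y \<le> \<theta>} \<union> (\<Union>(k, s)\<in>(A - I) \<times> \<Theta>. {y. \<theta> < lr P (W s) (c k) y}))"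
      using that \<Theta>
      by (intro measure_pmf.finite_measure_mono)
         (fastforce simp: decoding_set_def passes_def not_less)+
    also have "\<dots> \<le> G (c i) + ?M (\<Union>(k, s)\<in>(A - I) \<times> \<Theta>. {y. \<theta> < lr P (W s) (c k) y})"
      unfolding G_def by (rule measure_Un_le) auto
    also have "?M (\<Union>(k, s)\<in>(A - I) \<times> \<Theta>. {y. \<theta> < lr P (W s) (c k) y}) \<le>
        (\<Sum>(k, s)\<in>(A - I) \<times> \<Theta>. ?M {y. \<theta> < lr P (W s) (c k) y})"
      using measure_UNION_le[of "(A - I) \<times> \<Theta>" "\<lambda>(k, s). {y. \<theta> < lr P (W s) (c k) y}" "W t (c i)"] A \<Theta>
      by (auto simp: case_prod_beta)
    finally show ?thesis by (simp add: H_def sum.cartesian_product)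
  qed
  have H_le: "expect ?C (\<lambda>c. H s (c i) (c k)) \<le> 1 / \<theta>" if "i \<in> I" "k \<in> A - I" "s \<in> \<Theta>" for i k s
  proof -
    have "expect ?C (\<lambda>c. H s (c i) (c k)) = expect P (\<lambda>x. expect P (H s x))"
      using that A I P by (intro expect_Pi_pmf_pair) auto
    also have "\<dots> \<le> expect P (\<lambda>_. 1 / \<theta>)"
    proof (rule expect_mono[OF P])
      fix x assume x: "x \<in> set_pmf P"
      have fW: "finite (set_pmf (W t x))" using W x \<Theta> by auto
      \<comment> \<open>Markov's inequality, as a pointwise bound of the indicator.\<close>
      have "expect P (H s x) \<le> expect P (\<lambda>x'. expect (W t x) (\<lambda>y. lr P (W s) x' y / \<theta>))"
        unfolding H_def[abs_def] prob_eq_expect using \<theta> lr_nonneg[of P "W s"]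
        by (intro expect_mono P fW) (auto simp: indicator_def)
      \<comment> \<open>With \<open>y\<close> held fixed the inner mean is at most 1 whatever the
        law of \<open>y\<close>, so a mismatch between \<open>s\<close> and \<open>t\<close> does no
        harm.\<close>
      also have "\<dots> = expect (W t x) (\<lambda>y. expect P (\<lambda>x'. lr P (W s) x' y) / \<theta>)"
        using P fW by (subst expect_swap) auto
      also have "\<dots> \<le> expect (W t x) (\<lambda>_. 1 / \<theta>)"
        using expect_lr_le_1[OF P] \<theta> by (intro expect_mono fW divide_right_mono) auto
      finally show "expect P (H s x) \<le> 1 / \<theta>" by simp
    qed
    finally show ?thesis by simp
  qed
  have "expect ?C (\<lambda>c. expect (map_pmf c (pmf_of_set I))
      (\<lambda>x. measure_pmf.prob (W t x) (- decoding_set (passes \<Theta> P W \<theta>) A I c))) \<le>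
    expect ?C (\<lambda>c. (\<Sum>i\<in>I. G (c i) + (\<Sum>k\<in>A - I. \<Sum>s\<in>\<Theta>. H s (c i) (c k))) / ?n)"
    unfolding expect_uniform[OF fI I(2)]
    by (intro expect_mono fC divide_right_mono sum_mono pointwise) auto
  also have "\<dots> = (\<Sum>i\<in>I. expect ?C (\<lambda>c. G (c i)) +
      (\<Sum>k\<in>A - I. \<Sum>s\<in>\<Theta>. expect ?C (\<lambda>c. H s (c i) (c k)))) / ?n"
    using fC by (simp add: expect_sum expect_add)
  also have "\<dots> \<le> (\<Sum>i\<in>I. expect P G + (\<Sum>k\<in>A - I. \<Sum>s\<in>\<Theta>. 1 / \<theta>)) / ?n"
  proof (intro divide_right_mono sum_mono add_mono H_le)
    fix i assume "i \<in> I"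
    then show "expect ?C (\<lambda>c. G (c i)) \<le> expect P G"
      using A I by (subst expect_Pi_pmf_component) auto
  qed auto
  also have "\<dots> = expect P G + card (A - I) * card \<Theta> / \<theta>" using n by simp
  also have "\<dots> \<le> expect P G + card A * card \<Theta> / \<theta>"
    using \<theta> A
    by (intro add_left_mono divide_right_mono mult_right_mono of_nat_mono mult_right_mono card_mono) auto
  also have "expect P G = measure_pmf.prob (joint P (W t)) {(x, y). lr P (W t) x y \<le> \<theta>}"
    using P W \<Theta> by (simp add: prob_joint G_def[abs_def] vimage_def)
  finally show ?thesis .
qed

section \<open>Expurgation\<close>

text \<open>If fewer than \<open>J\<close> of the \<open>2 * J\<close> values were at most
  \<open>2 * e\<close>, more than \<open>J\<close> would exceed it and already push the sum above
  its bound. The map \<open>g\<close> renumbers the survivors as messages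
  \<open>{1..J}\<close>.\<close>

lemma exists_good_half:
  fixes f :: "nat \<Rightarrow> real" and e :: real
  assumes J: "J \<ge> 1" and nonneg: "\<And>j. j < 2 * J \<Longrightarrow> f j \<ge> 0"
    and sum: "(\<Sum>j<2 * J. f j) \<le> real (2 * J) * e"
  shows "\<exists>g. inj_on g {1..J} \<and> (\<forall>j\<in>{1..J}. g j < 2 * J \<and> f (g j) \<le> 2 * e)"
proof -
  define S where "S = {j. j < 2 * J \<and> f j \<le> 2 * e}"
  have [simp]: "finite S" by (simp add: S_def)
  have "J \<le> card S"
  proof (rule ccontr)
    assume "\<not> J \<le> card S"
    moreover have "card ({..<2 * J} - S) = 2 * J - card S"
      by (subst card_Diff_subset) (auto simp: S_def)
    ultimately have B: "card ({..<2 * J} - S) > J" by simp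
    have "0 \<le> (\<Sum>j<2 * J. f j)" using nonneg by (intro sum_nonneg) auto
    then have "0 \<le> 2 * J * e" using sum by linarith
    then have e: "e \<ge> 0" using J by (simp add: zero_le_mult_iff)
    have "2 * J * e \<le> (\<Sum>j\<in>{..<2 * J} - S. 2 * e)"
      using B e by (auto intro!: mult_right_mono)
    also have "\<dots> < (\<Sum>j\<in>{..<2 * J} - S. f j)"
    proof (rule sum_strict_mono)
      show "{..<2 * J} - S \<noteq> {}" using B by (metis card.empty not_less0)
    qed (auto simp: S_def)
    also have "\<dots> \<le> (\<Sum>j<2 * J. f j)"
      using nonneg by (intro sum_mono2) auto
    finally show False using sum by simp
  qed
  then obtain S' where "S' \<subseteq> S" "card S' = J" "finite S'"
    by (metis obtain_subset_with_card_n)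
  then obtain g where "bij_betw g {1..J} S'"
    by (metis card_atLeastAtMost diff_Suc_1 finite_atLeastAtMost finite_same_card_bij)
  with \<open>S' \<subseteq> S\<close> show ?thesis
    by (intro exI[of _ g]) (auto simp: bij_betw_def S_def)
qed

text \<open>Errors and divergences of all states are added into one quantity, so one choice of
  codebook and one expurgation control them all. Divergence from a fixed output law is used instead
  of mutual information because it is a property of each message alone and survives the deletion of
  others.\<close>

lemma one_shot_code:
  fixes P :: "'x pmf" and W :: "'t \<Rightarrow> 'x \<Rightarrow> 'y pmf" and V :: "'t \<Rightarrow> 'x \<Rightarrow> 'z pmf"
  assumes P: "finite (set_pmf P)"
    and W: "\<And>t x. t \<in> \<Theta> \<Longrightarrow> x \<in> set_pmf P \<Longrightarrow> finite (set_pmf (W t x))"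
    and V: "\<And>t x. t \<in> \<Theta> \<Longrightarrow> x \<in> set_pmf P \<Longrightarrow> finite (set_pmf (V t x))"
    and \<Theta>: "finite \<Theta>" and J: "J \<ge> 1" and L: "L \<ge> 1" and \<theta>: "\<theta> > 0"
  defines "e \<equiv> (\<Sum>t\<in>\<Theta>. measure_pmf.prob (joint P (W t)) {(x, y). lr P (W t) x y \<le> \<theta>} +
      real (2 * J * L * card \<Theta>) / \<theta> +
      expect (joint P (V t)) (\<lambda>(x, z). log 2 (1 + lr P (V t) x z / L)))"
  shows "\<exists>E D. (\<forall>j\<in>{1..J::nat}. set_pmf (E j) \<subseteq> set_pmf P) \<and> disjoint_family_on D {1..J} \<and>
    (\<forall>t\<in>\<Theta>. \<forall>j\<in>{1..J}. expect (E j) (\<lambda>x. measure_pmf.prob (W t x) (- D j)) \<le> 2 * e \<and>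
       kl (bind_pmf (E j) (V t)) (bind_pmf P (V t)) \<le> 2 * e)"
proof -
  \<comment> \<open>Twice as many messages as needed, since half are discarded below.\<close>
  define A where "A = {..<2 * J} \<times> {..<L}"
  define I where "I j = {j} \<times> {..<L}" for j :: nat
  define C where "C = Pi_pmf A undefined (\<lambda>_. P)"
  define E where "E c j = map_pmf c (pmf_of_set (I j))" for c :: "nat \<times> nat \<Rightarrow> 'x" and j
  \<comment> \<open>The test runs against all of \<open>A\<close>, discarded messages included, so
    the error bounds remain valid unchanged after expurgation.\<close>
  define D where "D c j = decoding_set (passes \<Theta> P W \<theta>) A (I j) c" for c and j :: nat
  define err where "err c t j = expect (E c j) (\<lambda>x. measure_pmf.prob (W t x) (- D c j))" for c t j
  define dvg where "dvg c t j = kl (bind_pmf (E c j) (V t)) (bind_pmf P (V t))" for c t j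
  define val where "val c j = (\<Sum>t\<in>\<Theta>. err c t j + dvg c t j)" for c j
  have A: "finite A" "card A = 2 * J * L" by (auto simp: A_def)
  have I: "I j \<subseteq> A" "I j \<noteq> {}" if "j < 2 * J" for j
    using that L by (auto simp: I_def A_def lessThan_empty_iff)
  have fI: "finite (I j)" "card (I j) = L" "I j \<noteq> {}" for j
    using L by (auto simp: I_def lessThan_empty_iff)
  have fC: "finite (set_pmf C)" unfolding C_def using A(1) P by (rule finite_set_Pi_pmf)
  have set_E: "set_pmf (E c j) \<subseteq> set_pmf P" if "c \<in> set_pmf C" "j < 2 * J" for c j
    using that I[of j] fI[of j] A by (auto simp: E_def C_def set_Pi_pmf PiE_dflt_def)
  have err: "err c t j \<ge> 0" for c t j unfolding err_def by (intro expect_nonneg) auto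
  have dvg: "dvg c t j \<ge> 0" if "c \<in> set_pmf C" "j < 2 * J" "t \<in> \<Theta>" for c t j
    unfolding dvg_def using set_E[OF that(1,2)] V[OF that(3)] finite_subset[OF _ P]
    by (intro kl_nonneg) auto
  have "expect C (\<lambda>c. val c j) \<le> e" if j: "j < 2 * J" for j
  proof -
    have "expect C (\<lambda>c. val c j) =
        (\<Sum>t\<in>\<Theta>. expect C (\<lambda>c. err c t j) + expect C (\<lambda>c. dvg c t j))"
      unfolding val_def using fC by (simp add: expect_sum expect_add)
    also have "\<dots> \<le> e"
      unfolding e_def
    proof (intro sum_mono add_mono)
      fix t assume t: "t \<in> \<Theta>"
      show "expect C (\<lambda>c. err c t j) \<le>
          measure_pmf.prob (joint P (W t)) {(x, y). lr P (W t) x y \<le> \<theta>} + real (2 * J * L * card \<Theta>) / \<theta>"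
        using expect_error_random_codebook[OF P W \<Theta> t A(1) I(1)[OF j] I(2)[OF j] \<theta>] A(2)
        by (simp add: C_def err_def E_def D_def)
      show "expect C (\<lambda>c. dvg c t j) \<le> expect (joint P (V t)) (\<lambda>(x, z). log 2 (1 + lr P (V t) x z / L))"
        using expect_kl_random_codebook[OF P V[OF t] A(1) I(1)[OF j] I(2)[OF j]] fI(2)
        by (simp add: C_def dvg_def E_def)
    qed
    finally show ?thesis .
  qed
  then have "expect C (\<lambda>c. \<Sum>j<2 * J. val c j) \<le> (\<Sum>j<2 * J. e)"
    unfolding expect_sum[OF fC] by (intro sum_mono) simp
  then have "expect C (\<lambda>c. \<Sum>j<2 * J. val c j) \<le> 2 * J * e" by simp
  with fC obtain c where c: "c \<in> set_pmf C" "(\<Sum>j<2 * J. val c j) \<le> 2 * J * e"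
    using expect_le_exists by blast
  have "val c j \<ge> 0" if "j < 2 * J" for j
    unfolding val_def using err dvg[OF c(1) that] by (intro sum_nonneg add_nonneg_nonneg) auto
  with exists_good_half[OF J _ c(2)] obtain g where g: "inj_on g {1..J}"
    "\<And>j. j \<in> {1..J} \<Longrightarrow> g j < 2 * J" "\<And>j. j \<in> {1..J} \<Longrightarrow> val c (g j) \<le> 2 * e" by blast
  have le: "err c t (g j) \<le> 2 * e \<and> dvg c t (g j) \<le> 2 * e" if "t \<in> \<Theta>" "j \<in> {1..J}" for t j
  proof -
    \<comment> \<open>All summands of \<open>val\<close> are nonnegative, so each one is bounded by
      the total.\<close>
    have "err c t (g j) + dvg c t (g j) \<le> val c (g j)"
      unfolding val_def
    proof (rule member_le_sum[OF that(1) _ \<Theta>])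
      show "0 \<le> err c s (g j) + dvg c s (g j)" if "s \<in> \<Theta> - {t}" for s
        using err[of c s "g j"] dvg[OF c(1) g(2)[OF \<open>j \<in> _\<close>], of s] that by simp
    qed
    with err[of c t "g j"] dvg[OF c(1) g(2)[OF that(2)] that(1)] g(3)[OF that(2)] show ?thesis by linarith
  qed
  have "disjoint_family_on (\<lambda>j. D c (g j)) {1..J}"
    unfolding disjoint_family_on_def
  proof (intro ballI impI)
    fix i j assume ij: "i \<in> {1..J}" "j \<in> {1..J}" "i \<noteq> j"
    then have "g i \<noteq> g j" using g(1) by (metis inj_onD)
    then have "I (g i) \<inter> I (g j) = {}" unfolding I_def by blast
    \<comment> \<open>Hence a codeword of \<open>g i\<close> that passes rules out decoding to
      \<open>g j\<close>.\<close>
    then have "I (g i) \<subseteq> A - I (g j)" using I(1)[OF g(2)[OF ij(1)]] by blast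
    then show "D c (g i) \<inter> D c (g j) = {}" unfolding D_def decoding_set_def by blast
  qed
  moreover have "set_pmf (E c (g j)) \<subseteq> set_pmf P" if "j \<in> {1..J}" for j
    using set_E[OF c(1) g(2)[OF that]] .
  ultimately show ?thesis
    using le unfolding err_def dvg_def
    by (intro exI[of _ "\<lambda>j. E c (g j)"] exI[of _ "\<lambda>j. D c (g j)"]) blast
qed

section \<open>Memoryless extensions\<close>

lemma finite_set_memoryless:
  "(\<And>x. x \<in> set xs \<Longrightarrow> finite (set_pmf (W x))) \<Longrightarrow> finite (set_pmf (memoryless W xs))"
  by (induction xs) auto

lemma finite_set_replicate_pmf: "finite (set_pmf p) \<Longrightarrow> finite (set_pmf (replicate_pmf n p))"
  by (induction n) auto

text \<open>An i.i.d. law is the output of a channel that ignores its input, which makes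
  \<open>pmf_memoryless_Cons\<close> available for it.\<close>

lemma replicate_pmf_eq_memoryless: "replicate_pmf n q = memoryless (\<lambda>_. q) (replicate n ())"
  by (induction n) (simp_all add: map_pmf_def pair_pmf_def bind_assoc_pmf bind_return_pmf)

lemma pmf_memoryless_Cons:
  "pmf (memoryless W (x # xs)) (y # ys) = pmf (W x) y * pmf (memoryless W xs) ys"
  by (simp add: pmf_memoryless prod.lessThan_Suc_shift del: prod.lessThan_Suc memoryless.simps)

text \<open>I.i.d. inputs give i.i.d. outputs: the first output letter may be drawn before the
  remaining inputs. This identifies the denominator of the ratio for words.\<close>

lemma bind_replicate_memoryless:
  "bind_pmf (replicate_pmf n p) (memoryless W) = replicate_pmf n (bind_pmf p W)"
proof (induction n)
  case (Suc n)
  have "bind_pmf (replicate_pmf (Suc n) p) (memoryless W) =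
      do {x \<leftarrow> p; xs \<leftarrow> replicate_pmf n p; y \<leftarrow> W x; ys \<leftarrow> memoryless W xs; return_pmf (y # ys)}"
    by (simp add: bind_assoc_pmf bind_return_pmf map_pmf_def pair_pmf_def)
  also have "\<dots> = do {x \<leftarrow> p; y \<leftarrow> W x; xs \<leftarrow> replicate_pmf n p; ys \<leftarrow> memoryless W xs; return_pmf (y # ys)}"
    by (subst bind_commute_pmf[of "replicate_pmf n p"]) (rule refl)
  also have "\<dots> = replicate_pmf (Suc n) (bind_pmf p W)"
    by (simp add: bind_assoc_pmf Suc.IH[symmetric])
  finally show ?case .
qed (simp add: bind_return_pmf)

lemma lr_Cons:
  "lr (replicate_pmf (Suc n) p) (memoryless W) (x # xs) (y # ys) =
    lr p W x y * lr (replicate_pmf n p) (memoryless W) xs ys"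
proof -
  have "pmf (replicate_pmf (Suc n) q) (y # ys) = pmf q y * pmf (replicate_pmf n q) ys" for q
    unfolding replicate_pmf_eq_memoryless replicate_Suc by (rule pmf_memoryless_Cons)
  then show ?thesis
    unfolding lr_def bind_replicate_memoryless pmf_memoryless_Cons by simp
qed

lemma expect_replicate_pmf_Suc:
  assumes "finite (set_pmf p)"
  shows "expect (replicate_pmf (Suc n) p) h = expect p (\<lambda>x. expect (replicate_pmf n p) (\<lambda>xs. h (x # xs)))"
  using assms finite_set_replicate_pmf[OF assms] by (simp add: expect_bind)

lemma expect_joint_memoryless:
  assumes p: "finite (set_pmf p)" and W: "\<And>x. x \<in> set_pmf p \<Longrightarrow> finite (set_pmf (W x))"
  shows "expect (joint (replicate_pmf n p) (memoryless W)) h =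
    expect (replicate_pmf n p) (\<lambda>xs. expect (memoryless W xs) (\<lambda>ys. h (xs, ys)))"
  using assms
  by (intro expect_joint finite_set_replicate_pmf finite_set_memoryless)
     (auto simp: set_replicate_pmf lists_eq_set)

text \<open>The ratio of a word is a product over independent letters, so its moments multiply. The
  exponent is any real: a negative one is used for the receiver, a positive one for the
  eavesdropper.\<close>

lemma expect_lr_powr_memoryless:
  assumes p: "finite (set_pmf p)" and W: "\<And>x. x \<in> set_pmf p \<Longrightarrow> finite (set_pmf (W x))"
  shows "expect (joint (replicate_pmf n p) (memoryless W))
      (\<lambda>(xs, ys). lr (replicate_pmf n p) (memoryless W) xs ys powr s) =
    expect (joint p W) (\<lambda>(x, y). lr p W x y powr s) ^ n"
proof (induction n)
  case 0
  then show ?case by (simp add: joint_def bind_return_pmf lr_def)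
next
  case (Suc n)
  let ?l = "\<lambda>n xs ys. lr (replicate_pmf n p) (memoryless W) xs ys powr s"
  have fp: "finite (set_pmf (replicate_pmf n p))" for n using p by (rule finite_set_replicate_pmf)
  have fW: "finite (set_pmf (memoryless W xs))" if "xs \<in> set_pmf (replicate_pmf n p)" for xs n
    using that W by (intro finite_set_memoryless) (auto simp: set_replicate_pmf lists_eq_set)
  have "expect (joint (replicate_pmf (Suc n) p) (memoryless W)) (\<lambda>(xs, ys). ?l (Suc n) xs ys) =
    expect p (\<lambda>x. expect (replicate_pmf n p) (\<lambda>xs.
      expect (memoryless W (x # xs)) (\<lambda>ys. ?l (Suc n) (x # xs) ys)))"
    by (subst expect_joint_memoryless)
      (use p W in \<open>auto simp: expect_replicate_pmf_Suc simp del: replicate_pmf.simps memoryless.simps\<close>)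
  also have "\<dots> = expect p (\<lambda>x. expect (replicate_pmf n p) (\<lambda>xs.
      expect (W x) (\<lambda>y. expect (memoryless W xs) (\<lambda>ys. lr p W x y powr s * ?l n xs ys))))"
    using W fW
    by (intro expect_cong) (simp add: expect_pair case_prod_unfold lr_Cons powr_mult lr_nonneg
        del: replicate_pmf.simps)
  also have "\<dots> = expect (joint p W) (\<lambda>(x, y). lr p W x y powr s) *
      expect (joint (replicate_pmf n p) (memoryless W)) (\<lambda>(xs, ys). ?l n xs ys)"
    by (subst expect_joint_memoryless[OF p W], simp, subst expect_joint[OF p W]) simp_all
  finally show ?case using Suc.IH by simp
qed

text \<open>For \<open>u \<le> 1\<close> the bound comes from
  \<open>ln (1 + u) \<le> u \<le> u powr s\<close>, for larger \<open>u\<close> from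
  \<open>ln x \<le> x powr s / s\<close> and \<open>1 + u \<le> 2 * u\<close>. It reduces the
  leakage to a fractional moment of the ratio.\<close>

lemma log_1_plus_le:
  fixes u s :: real
  assumes u: "0 \<le> u" and s: "0 < s" "s \<le> 1"
  shows "log 2 (1 + u) \<le> 2 / (s * ln 2) * u powr s"
proof -
  have "ln (1 + u) \<le> 2 / s * u powr s"
  proof (cases "u \<le> 1")
    case True
    have "ln (1 + u) \<le> u" using u by (rule ln_add_one_self_le_self)
    also have "u \<le> u powr s"
      using True u s powr_mono'[of s 1 u] by (cases "u = 0") auto
    also have "1 * u powr s \<le> 2 / s * u powr s"
      using s by (intro mult_right_mono) (auto simp: field_simps)
    finally show ?thesis by simp
  next
    case False
    have "ln (1 + u) \<le> (1 + u) powr s / s" using False s by (intro ln_powr_bound) auto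
    also have "(1 + u) powr s \<le> (2 * u) powr s" using False s by (intro powr_mono2) auto
    also have "(2 * u) powr s = 2 powr s * u powr s" using u by (simp add: powr_mult)
    also have "2 powr s \<le> (2::real) powr 1" using s by (intro powr_mono) auto
    finally show ?thesis using s by (simp add: divide_right_mono mult_right_mono)
  qed
  then have "ln (1 + u) / ln 2 \<le> 2 / s * u powr s / ln 2" by (intro divide_right_mono) auto
  then show ?thesis by (simp add: log_def)
qed

text \<open>On the support the ratio is positive, so the exponential undoes the logarithm.\<close>

lemma powr_log_lr:
  assumes "xy \<in> set_pmf (joint p W)"
  shows "2 powr (s * log 2 (case xy of (x, y) \<Rightarrow> lr p W x y)) = (case xy of (x, y) \<Rightarrow> lr p W x y powr s)"
  using assms lr_pos[of "fst xy" p "snd xy" W]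
  by (auto simp: set_joint powr_powr[symmetric] mult.commute[of s] split: prod.splits)

text \<open>Chernoff's bound for the lower tail: the negated log-ratio of a letter has mean
  \<open>- mutual_info p W\<close>, and a small exponential moment of it is raised to the power
  \<open>n\<close>.\<close>

lemma prob_lr_le_memoryless:
  fixes p :: "'a::countable pmf" and W :: "'a \<Rightarrow> 'b::countable pmf"
  assumes p: "finite (set_pmf p)" and W: "\<And>x. x \<in> set_pmf p \<Longrightarrow> finite (set_pmf (W x))"
    and m: "m < mutual_info p W"
  shows "\<exists>r. 0 \<le> r \<and> r < 1 \<and> (\<forall>n. measure_pmf.prob (joint (replicate_pmf n p) (memoryless W))
    {(xs, ys). lr (replicate_pmf n p) (memoryless W) xs ys \<le> 2 powr (n * m)} \<le> r ^ n)"
proof -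
  \<comment> \<open>The midpoint leaves a gap on both sides: one for the strict hypothesis of
    \<open>exp_moment_bound\<close>, the other to make \<open>r\<close> less than 1.\<close>
  define m' where "m' = (m + mutual_info p W) / 2"
  have m': "m < m'" "m' < mutual_info p W" using m by (auto simp: m'_def)
  have fin: "finite (set_pmf (joint p W))" using p W by (rule finite_set_joint)
  have "expect (joint p W) (\<lambda>xy. - log 2 (case xy of (x, y) \<Rightarrow> lr p W x y)) < - m'"
    using m' by (simp add: mutual_info_eq_expect[OF p W] case_prod_unfold)
  from exp_moment_bound[OF fin this] obtain s where s: "0 < s" "s \<le> 1" and
    le: "expect (joint p W) (\<lambda>xy. 2 powr (s * - log 2 (case xy of (x, y) \<Rightarrow> lr p W x y)))
      \<le> 2 powr (s * - m')" by blast
  have "expect (joint p W) (\<lambda>xy. 2 powr (s * - log 2 (case xy of (x, y) \<Rightarrow> lr p W x y))) =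
      expect (joint p W) (\<lambda>(x, y). lr p W x y powr (- s))"
    using powr_log_lr[of _ p W "- s"] by (intro expect_cong) simp
  with le have le: "expect (joint p W) (\<lambda>(x, y). lr p W x y powr (- s)) \<le> 2 powr (s * - m')" by simp
  define r :: real where "r = 2 powr (s * (m - m'))"
  have "measure_pmf.prob (joint (replicate_pmf n p) (memoryless W))
    {(xs, ys). lr (replicate_pmf n p) (memoryless W) xs ys \<le> 2 powr (n * m)} \<le> r ^ n" for n :: nat
  proof -
    let ?J = "joint (replicate_pmf n p) (memoryless W)"
    let ?l = "\<lambda>(xs, ys). lr (replicate_pmf n p) (memoryless W) xs ys"
    let ?A = "{(xs, ys). lr (replicate_pmf n p) (memoryless W) xs ys \<le> 2 powr (n * m)}"
    have "finite (set_pmf ?J)"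
      using p W by (intro finite_set_joint finite_set_replicate_pmf finite_set_memoryless)
        (auto simp: set_replicate_pmf lists_eq_set)
    \<comment> \<open>Markov's inequality for the power \<open>- s\<close> of the ratio.\<close>
    then have "measure_pmf.prob ?J ?A \<le> expect ?J (\<lambda>z. (2 powr (n * m)) powr s * ?l z powr (- s))"
      unfolding prob_eq_expect
    proof (rule expect_mono)
      fix z assume z: "z \<in> set_pmf ?J"
      obtain xs ys where zz: "z = (xs, ys)" by (cases z)
      have pos: "0 < lr (replicate_pmf n p) (memoryless W) xs ys"
        using z by (intro lr_pos) (auto simp: zz set_joint)
      show "indicator ?A z \<le> (2 powr (n * m)) powr s * ?l z powr (- s)"
      proof (cases "z \<in> ?A")
        case True
        have "1 = ?l z powr s * ?l z powr (- s)" using pos by (simp add: zz powr_add[symmetric])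
        also have "\<dots> \<le> (2 powr (n * m)) powr s * ?l z powr (- s)"
          using True pos s by (intro mult_right_mono powr_mono2) (auto simp: zz)
        finally show ?thesis using True by simp
      qed auto
    qed
    also have "\<dots> = 2 powr (n * m * s) * expect (joint p W) (\<lambda>(x, y). lr p W x y powr (- s)) ^ n"
      using expect_lr_powr_memoryless[OF p W, where n = n and s = "- s"]
      by (simp add: powr_powr case_prod_unfold)
    also have "\<dots> \<le> 2 powr (n * m * s) * (2 powr (s * - m')) ^ n"
      using le by (intro mult_left_mono power_mono expect_nonneg) auto
    also have "\<dots> = r ^ n"
      by (simp add: r_def powr_realpow[symmetric] powr_powr powr_add[symmetric] algebra_simps)
    finally show ?thesis .
  qed
  moreover have "0 \<le> r" "r < 1" using s m' by (auto simp: r_def mult_pos_neg powr_less_one)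
  ultimately show ?thesis by blast
qed

text \<open>The counterpart for the upper side: \<open>log_1_plus_le\<close> reduces the mean to the
  \<open>s\<close>-th moment of the ratio divided by \<open>L\<close>, and
  \<open>L \<ge> 2 powr (n * m)\<close> outweighs the growth of that moment. Neither
  \<open>r\<close> nor \<open>K\<close> depends on \<open>n\<close> or \<open>L\<close>.\<close>

lemma expect_log_lr_memoryless:
  fixes p :: "'a::countable pmf" and V :: "'a \<Rightarrow> 'b::countable pmf"
  assumes p: "finite (set_pmf p)" and V: "\<And>x. x \<in> set_pmf p \<Longrightarrow> finite (set_pmf (V x))"
    and m: "mutual_info p V < m"
  shows "\<exists>r K. 0 \<le> r \<and> r < 1 \<and> (\<forall>n L. 2 powr (n * m) \<le> L \<longrightarrow>
    expect (joint (replicate_pmf n p) (memoryless V))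
      (\<lambda>(xs, zs). log 2 (1 + lr (replicate_pmf n p) (memoryless V) xs zs / L)) \<le> K * r ^ n)"
proof -
  define m' where "m' = (m + mutual_info p V) / 2"
  have m': "m' < m" "mutual_info p V < m'" using m by (auto simp: m'_def)
  have fin: "finite (set_pmf (joint p V))" using p V by (rule finite_set_joint)
  have "expect (joint p V) (\<lambda>xy. log 2 (case xy of (x, y) \<Rightarrow> lr p V x y)) < m'"
    using m' by (simp add: mutual_info_eq_expect[OF p V] case_prod_unfold)
  from exp_moment_bound[OF fin this] obtain s where s: "0 < s" "s \<le> 1" and
    le: "expect (joint p V) (\<lambda>xy. 2 powr (s * log 2 (case xy of (x, y) \<Rightarrow> lr p V x y)))
      \<le> 2 powr (s * m')" by blast
  have "expect (joint p V) (\<lambda>xy. 2 powr (s * log 2 (case xy of (x, y) \<Rightarrow> lr p V x y))) =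
      expect (joint p V) (\<lambda>(x, y). lr p V x y powr s)"
    using powr_log_lr[of _ p V s] by (intro expect_cong) simp
  with le have le: "expect (joint p V) (\<lambda>(x, y). lr p V x y powr s) \<le> 2 powr (s * m')" by simp
  define r :: real where "r = 2 powr (s * (m' - m))"
  define K where "K = 2 / (s * ln 2)"
  have "expect (joint (replicate_pmf n p) (memoryless V))
      (\<lambda>(xs, zs). log 2 (1 + lr (replicate_pmf n p) (memoryless V) xs zs / L)) \<le> K * r ^ n"
    if L: "2 powr (n * m) \<le> L" for n :: nat and L :: real
  proof -
    let ?J = "joint (replicate_pmf n p) (memoryless V)"
    let ?l = "\<lambda>(xs, ys). lr (replicate_pmf n p) (memoryless V) xs ys"
    have L0: "L > 0" using L powr_gt_zero[of 2 "n * m"] by linarith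
    have "finite (set_pmf ?J)"
      using p V by (intro finite_set_joint finite_set_replicate_pmf finite_set_memoryless)
        (auto simp: set_replicate_pmf lists_eq_set)
    then have "expect ?J (\<lambda>z. log 2 (1 + ?l z / L)) \<le>
        expect ?J (\<lambda>z. K * (1 / (2 powr (n * m)) powr s * ?l z powr s))"
    proof (rule expect_mono)
      fix z
      have l: "?l z \<ge> 0" by (simp add: lr_nonneg split: prod.splits)
      have "log 2 (1 + ?l z / L) \<le> K * (?l z / L) powr s"
        unfolding K_def using l L0 s by (intro log_1_plus_le) auto
      also have "\<dots> \<le> K * (?l z / 2 powr (n * m)) powr s"
        using l L L0 s by (intro mult_left_mono powr_mono2 divide_left_mono) (auto simp: K_def)
      also have "\<dots> = K * (1 / (2 powr (n * m)) powr s * ?l z powr s)"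
        using l by (simp add: powr_divide)
      finally show "log 2 (1 + ?l z / L) \<le> K * (1 / (2 powr (n * m)) powr s * ?l z powr s)" .
    qed
    also have "\<dots> = K * (2 powr (- (n * m * s)) * expect (joint p V) (\<lambda>(x, y). lr p V x y powr s) ^ n)"
      using expect_lr_powr_memoryless[OF p V, where n = n and s = s]
      by (simp add: powr_powr powr_minus_divide case_prod_unfold)
    also have "\<dots> \<le> K * (2 powr (- (n * m * s)) * (2 powr (s * m')) ^ n)"
      using le s by (intro mult_left_mono power_mono expect_nonneg) (auto simp: K_def)
    also have "\<dots> = K * r ^ n"
      by (simp add: r_def powr_realpow[symmetric] powr_powr powr_add[symmetric] algebra_simps)
    finally show ?thesis by (simp add: case_prod_unfold)
  qed
  moreover have "0 \<le> r" "r < 1" using s m' by (auto simp: r_def mult_pos_neg powr_less_one)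
  ultimately show ?thesis by blast
qed

section \<open>Existence of an optimal input distribution\<close>

lemma continuous_on_xlog2x: "continuous_on {0..} (\<lambda>x::real. x * log 2 x)"
proof -
  have "((\<lambda>x::real. x * log 2 x) \<longlongrightarrow> y * log 2 y) (at y within {0..})" if "y \<ge> 0" for y
  proof (cases "y = 0")
    case True
    \<comment> \<open>The factor \<open>x\<close> makes the value at 0 equal to 0, which agrees with
      this limit.\<close>
    have "((\<lambda>x::real. x * log 2 x) \<longlongrightarrow> 0) (at_right 0)" by real_asymp
    with True show ?thesis by (simp add: at_within_Ici_at_right)
  next
    case False
    with that show ?thesis by (auto intro!: tendsto_eq_intros)
  qed
  then show ?thesis by (auto simp: continuous_on_def)
qed

text \<open>Output entropy minus conditional entropy. The sums run over the fixed alphabets and not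
  over supports that vary with \<open>p\<close>, so continuity in \<open>p\<close> can be read
  off.\<close>

lemma mutual_info_eq_entropies:
  fixes p :: "'a::finite pmf" and W :: "'a \<Rightarrow> 'b::finite pmf"
  shows "mutual_info p W =
    (\<Sum>x\<in>UNIV. pmf p x * (\<Sum>y\<in>UNIV. pmf (W x) y * log 2 (pmf (W x) y))) -
    (\<Sum>y\<in>UNIV. (\<Sum>x\<in>UNIV. pmf p x * pmf (W x) y) * log 2 (\<Sum>x\<in>UNIV. pmf p x * pmf (W x) y))"
proof -
  have q: "pmf (bind_pmf p W) y = (\<Sum>x\<in>UNIV. pmf p x * pmf (W x) y)" for y
    by (simp add: pmf_bind integral_measure_pmf[of UNIV])
  have "mutual_info p W = expect p (\<lambda>x. expect (W x) (\<lambda>y. log 2 (pmf (W x) y) - log 2 (pmf (bind_pmf p W) y)))"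
    unfolding mutual_info_eq_kl[of p W, OF finite finite] kl_def
  proof (intro expect_cong)
    fix x y assume "x \<in> set_pmf p" "y \<in> set_pmf (W x)"
    then have "0 < pmf (W x) y" "0 < pmf (bind_pmf p W) y" by (auto simp: pmf_positive_iff)
    then show "log 2 (pmf (W x) y / pmf (bind_pmf p W) y) =
        log 2 (pmf (W x) y) - log 2 (pmf (bind_pmf p W) y)" by (simp add: log_divide)
  qed
  also have "\<dots> = expect p (\<lambda>x. expect (W x) (\<lambda>y. log 2 (pmf (W x) y))) -
      expect (bind_pmf p W) (\<lambda>y. log 2 (pmf (bind_pmf p W) y))"
    by (simp add: expect_diff expect_bind)
  finally show ?thesis
    by (simp add: integral_measure_pmf[of UNIV] q)
qed

lemma continuous_on_Max:
  fixes f :: "'i \<Rightarrow> 'a::topological_space \<Rightarrow> real"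
  assumes "finite I" "I \<noteq> {}" "\<And>i. i \<in> I \<Longrightarrow> continuous_on S (f i)"
  shows "continuous_on S (\<lambda>x. MAX i\<in>I. f i x)"
  using assms by (induction I rule: finite_ne_induct) (auto intro!: continuous_on_max)

lemma continuous_on_Min:
  fixes f :: "'i \<Rightarrow> 'a::topological_space \<Rightarrow> real"
  assumes "finite I" "I \<noteq> {}" "\<And>i. i \<in> I \<Longrightarrow> continuous_on S (f i)"
  shows "continuous_on S (\<lambda>x. MIN i\<in>I. f i x)"
  using assms by (induction I rule: finite_ne_induct) (auto intro!: continuous_on_min)

text \<open>A continuous function on the compact probability simplex attains its maximum; the
  simplex is realized as the set \<open>S\<close> of vectors, and \<open>\<pi>\<close> carries it
  onto the distributions.\<close>

lemma rate_difference_attains_max: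
  fixes W :: "nat \<Rightarrow> 'a::finite \<Rightarrow> 'b::finite pmf" and V :: "nat \<Rightarrow> 'a \<Rightarrow> 'c::finite pmf"
  assumes "T \<ge> 1"
  shows "\<exists>p. \<forall>q. rate_difference T W V q \<le> rate_difference T W V p"
proof -
  define S :: "(real ^ 'a) set" where "S = {v. (\<forall>x. 0 \<le> v $ x) \<and> (\<Sum>x\<in>UNIV. v $ x) = 1}"
  define \<pi> :: "real ^ 'a \<Rightarrow> 'a pmf" where "\<pi> v = embed_pmf (\<lambda>x. v $ x)" for v
  have pmf_\<pi>: "pmf (\<pi> v) x = v $ x" if "v \<in> S" for v x
    unfolding \<pi>_def using that
    by (intro pmf_embed_pmf) (auto simp: S_def nn_integral_count_space_finite)
  have "closed S"
    unfolding S_def by (intro closed_Collect_conj closed_Collect_all closed_Collect_le closed_Collect_eq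
        continuous_intros)
  moreover have "bounded S"
  proof (rule boundedI)
    fix v assume "v \<in> S"
    then have "(\<Sum>x\<in>UNIV. \<bar>v $ x\<bar>) = 1" by (simp add: S_def)
    then show "norm v \<le> 1" using norm_le_l1_cart[of v] by simp
  qed
  ultimately have "compact S" by (simp add: compact_eq_bounded_closed)
  have cont: "continuous_on S (\<lambda>v. mutual_info (\<pi> v) U)" for U :: "'a \<Rightarrow> 'd::finite pmf"
  proof -
    have "continuous_on S (\<lambda>v. (\<Sum>x\<in>UNIV. v $ x * pmf (U x) y) * log 2 (\<Sum>x\<in>UNIV. v $ x * pmf (U x) y))" for y
      by (rule continuous_on_compose2[OF continuous_on_xlog2x])
         (auto intro!: continuous_intros sum_nonneg simp: S_def)
    then have "continuous_on S (\<lambda>v.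
      (\<Sum>x\<in>UNIV. v $ x * (\<Sum>y\<in>UNIV. pmf (U x) y * log 2 (pmf (U x) y))) -
      (\<Sum>y\<in>UNIV. (\<Sum>x\<in>UNIV. v $ x * pmf (U x) y) * log 2 (\<Sum>x\<in>UNIV. v $ x * pmf (U x) y)))"
      by (intro continuous_on_diff continuous_on_sum continuous_on_mult_right continuous_on_component)
        (auto intro!: continuous_intros)
    then show ?thesis
      by (rule continuous_on_eq) (simp add: mutual_info_eq_entropies pmf_\<pi>)
  qed
  have ne: "finite {1..T}" "{1..T} \<noteq> {}" using assms by auto
  have "continuous_on S (\<lambda>v. rate_difference T W V (\<pi> v))"
    unfolding rate_difference_def
    by (intro continuous_on_diff continuous_on_Max continuous_on_Min ne cont)
  moreover have vec: "(\<chi> x. pmf q x) \<in> S" for q :: "'a pmf"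
    by (simp add: S_def sum_pmf_eq_1)
  then have "S \<noteq> {}" by blast
  ultimately obtain v where v: "\<And>w. w \<in> S \<Longrightarrow> rate_difference T W V (\<pi> w) \<le> rate_difference T W V (\<pi> v)"
    using continuous_attains_sup[OF \<open>compact S\<close>] by blast
  have "\<pi> (\<chi> x. pmf q x) = q" for q
    using vec[of q] by (intro pmf_eqI) (simp add: pmf_\<pi>)
  with v[OF vec] have "\<forall>q. rate_difference T W V q \<le> rate_difference T W V (\<pi> v)" by simp
  then show ?thesis by blast
qed

section \<open>Achievable rates\<close>

lemma finite_words: "finite (words n :: 'a::finite list set)"
  using finite_lists_length_eq[of "UNIV :: 'a set" n] by simp

text \<open>Decoding sets are cut down to \<open>words n\<close> because \<open>is_code\<close>
  demands it; this adds no error inside \<open>words n\<close>. The lower bound 0 prepares a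
  sandwich argument.\<close>

lemma max_error_bounds:
  fixes W :: "nat \<Rightarrow> 'a::finite \<Rightarrow> 'b pmf"
  assumes "T \<ge> 1" "J \<ge> 1" and E: "\<And>j. j \<in> {1..J} \<Longrightarrow> set_pmf (E j) \<subseteq> words n"
    and err: "\<And>t j. t \<in> {1..T} \<Longrightarrow> j \<in> {1..J} \<Longrightarrow>
      expect (E j) (\<lambda>x. measure_pmf.prob (memoryless (W t) x) (- D j)) \<le> e"
  shows "max_error T W n J E (\<lambda>j. D j \<inter> words n) \<in> {0..e}"
proof -
  define err where "err t j = (\<Sum>x\<in>words n. pmf (E j) x *
    measure_pmf.prob (memoryless (W t) x) (words n - D j \<inter> words n))" for t j
  have "err t j \<in> {0..e}" if "t \<in> {1..T}" "j \<in> {1..J}" for t j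
  proof -
    have "err t j \<le> (\<Sum>x\<in>words n. pmf (E j) x * measure_pmf.prob (memoryless (W t) x) (- D j))"
      unfolding err_def
      by (intro sum_mono mult_left_mono measure_pmf.finite_measure_mono) auto
    also have "\<dots> = expect (E j) (\<lambda>x. measure_pmf.prob (memoryless (W t) x) (- D j))"
      using E[OF that(2)] by (subst integral_measure_pmf[OF finite_words, of _ _ n]) auto
    finally show ?thesis using err[OF that] by (auto simp: err_def intro!: sum_nonneg)
  qed
  \<comment> \<open>Finite maxima are attained, so the maximum inherits both bounds.\<close>
  moreover have "(MAX t\<in>{1..T}. MAX j\<in>{1..J}. err t j) \<in> (\<lambda>(t, j). err t j) ` ({1..T} \<times> {1..J})"
  proof -
    have "(MAX t\<in>{1..T}. MAX j\<in>{1..J}. err t j) \<in> (\<lambda>t. MAX j\<in>{1..J}. err t j) ` {1..T}"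
      using assms by (intro Max_in) auto
    then obtain t where t: "t \<in> {1..T}"
      "(MAX t\<in>{1..T}. MAX j\<in>{1..J}. err t j) = (MAX j\<in>{1..J}. err t j)" by blast
    have "(MAX j\<in>{1..J}. err t j) \<in> err t ` {1..J}"
      using assms by (intro Max_in) auto
    with t show ?thesis by force
  qed
  ultimately show ?thesis unfolding max_error_def err_def by force
qed

text \<open>By \<open>mutual_info_le_kl\<close> the reference law \<open>Q t\<close> need not be the
  output law of the code.\<close>

lemma max_leakage_bounds:
  fixes V :: "nat \<Rightarrow> 'a \<Rightarrow> 'c::countable pmf"
  assumes "T \<ge> 1" "J \<ge> 1"
    and fin: "\<And>t j. t \<in> {1..T} \<Longrightarrow> j \<in> {1..J} \<Longrightarrow> finite (set_pmf (bind_pmf (E j) (memoryless (V t))))"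
    and sub: "\<And>t j. t \<in> {1..T} \<Longrightarrow> j \<in> {1..J} \<Longrightarrow>
      set_pmf (bind_pmf (E j) (memoryless (V t))) \<subseteq> set_pmf (Q t)"
    and kl: "\<And>t j. t \<in> {1..T} \<Longrightarrow> j \<in> {1..J} \<Longrightarrow> kl (bind_pmf (E j) (memoryless (V t))) (Q t) \<le> e"
  shows "max_leakage T V J E \<in> {0..e}"
proof -
  define I where "I t = mutual_info (pmf_of_set {1..J}) (\<lambda>j. bind_pmf (E j) (memoryless (V t)))" for t
  have set_J: "set_pmf (pmf_of_set {1..J}) = {1..J}" using assms by (intro set_pmf_of_set) auto
  have "I t \<in> {0..e}" if t: "t \<in> {1..T}" for t
  proof -
    have "0 \<le> I t" unfolding I_def by (rule mutual_info_nonneg) (use set_J fin[OF t] in auto)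
    moreover have "I t \<le> expect (pmf_of_set {1..J}) (\<lambda>j. kl (bind_pmf (E j) (memoryless (V t))) (Q t))"
      unfolding I_def by (rule mutual_info_le_kl) (use set_J fin[OF t] sub[OF t] in auto)
    moreover have "\<dots> \<le> expect (pmf_of_set {1..J}) (\<lambda>_. e)"
      using set_J kl[OF t] by (intro expect_mono) auto
    ultimately show ?thesis by simp
  qed
  moreover have "(MAX t\<in>{1..T}. I t) \<in> I ` {1..T}"
    using assms by (intro Max_in) auto
  ultimately show ?thesis unfolding max_leakage_def I_def by force
qed

text \<open>A single message, always sent as the same word, is decoded without error and leaks
  nothing. This covers the case of a nonpositive rate difference.\<close>

lemma achievable_0:
  fixes W :: "nat \<Rightarrow> 'a::finite \<Rightarrow> 'b pmf" and V :: "nat \<Rightarrow> 'a \<Rightarrow> 'c::finite pmf"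
  assumes "T \<ge> 1"
  shows "achievable_secrecy_rate T W V 0"
proof -
  define E :: "nat \<Rightarrow> nat \<Rightarrow> 'a list pmf" where "E n j = return_pmf (replicate n undefined)" for n j
  have "max_error T W n 1 (E n) (\<lambda>j. UNIV \<inter> words n) \<in> {0..0}" for n
    using assms by (intro max_error_bounds) (auto simp: E_def)
  then have err: "max_error T W n 1 (E n) (\<lambda>j. UNIV \<inter> words n) = 0" for n by simp
  have "max_leakage T V 1 (E n) \<in> {0..0}" for n
    using assms
    by (intro max_leakage_bounds[where Q = "\<lambda>t. memoryless (V t) (replicate n undefined)"])
       (auto simp: E_def bind_return_pmf kl_self intro!: finite_set_memoryless)
  then have leak: "max_leakage T V 1 (E n) = 0" for n by simp
  show ?thesis
    unfolding achievable_secrecy_rate_def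
    by (intro conjI exI[of _ "\<lambda>_. 1"] exI[of _ E] exI[of _ "\<lambda>n j. UNIV \<inter> words n"])
       (auto simp: err[simplified] leak[simplified] is_code_def E_def disjoint_family_on_def
         simp flip: zero_ereal_def intro!: Liminf_bounded)
qed

lemma achievable_below_rate_difference:
  fixes W :: "nat \<Rightarrow> 'a::finite \<Rightarrow> 'b::finite pmf" and V :: "nat \<Rightarrow> 'a \<Rightarrow> 'c::finite pmf"
  assumes T: "T \<ge> 1" and R: "0 \<le> R" "R < rate_difference T W V p"
  shows "achievable_secrecy_rate T W V R"
proof -
  \<comment> \<open>One third of the slack separates \<open>m1\<close> from the receiver's
    informations, one third separates \<open>m2\<close> from the eavesdropper's, and the last makes
    \<open>R + m2 - m1\<close> negative.\<close>
  define \<delta> where "\<delta> = (rate_difference T W V p - R) / 3"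
  define m1 where "m1 = (MIN t\<in>{1..T}. mutual_info p (W t)) - \<delta>"
  define m2 where "m2 = (MAX t\<in>{1..T}. mutual_info p (V t)) + \<delta>"
  have \<delta>: "\<delta> > 0" using R by (simp add: \<delta>_def)
  have m: "R + m2 - m1 = - \<delta>"
    unfolding m1_def m2_def \<delta>_def rate_difference_def by (simp add: field_simps)
  have m1: "m1 < mutual_info p (W t)" and m2: "mutual_info p (V t) < m2" if "t \<in> {1..T}" for t
  proof -
    have "(MIN t\<in>{1..T}. mutual_info p (W t)) \<le> mutual_info p (W t)"
      "mutual_info p (V t) \<le> (MAX t\<in>{1..T}. mutual_info p (V t))"
      using that by (auto intro!: Min_le Max_ge)
    then show "m1 < mutual_info p (W t)" "mutual_info p (V t) < m2"
      using \<delta> by (auto simp: m1_def m2_def)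
  qed
  have "0 < m2"
    using m2[of 1] T mutual_info_nonneg[of p "V 1"] by simp
  define P where "P n = replicate_pmf n p" for n
  define J where "J n = nat \<lceil>2 powr (n * R)\<rceil>" for n :: nat
  define L where "L n = nat \<lceil>2 powr (n * m2)\<rceil>" for n :: nat
  define \<theta> :: "nat \<Rightarrow> real" where "\<theta> n = 2 powr (n * m1)" for n
  \<comment> \<open>For a nonnegative rate the power is at least 1, so rounding up at most doubles
    it.\<close>
  have ceil: "2 powr (n * x) \<le> nat \<lceil>2 powr (n * x)\<rceil>" "nat \<lceil>2 powr (n * x)\<rceil> \<le> 2 * 2 powr (n * x)"
    "nat \<lceil>2 powr (n * x)\<rceil> \<ge> 1" if "x \<ge> 0" for n :: nat and x :: real
  proof -
    have "2 powr (n * x) \<ge> 2 powr 0" using that by (intro powr_mono) auto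
    then have 1: "2 powr (n * x) \<ge> 1" by simp
    then show "2 powr (n * x) \<le> nat \<lceil>2 powr (n * x)\<rceil>" "nat \<lceil>2 powr (n * x)\<rceil> \<le> 2 * 2 powr (n * x)"
      by linarith+
    from 1 show "nat \<lceil>2 powr (n * x)\<rceil> \<ge> 1" by linarith
  qed
  note J = ceil[OF R(1), folded J_def] and L = ceil[OF less_imp_le[OF \<open>0 < m2\<close>], folded L_def]
  define fail where "fail n t = measure_pmf.prob (joint (P n) (memoryless (W t)))
      {(x, y). lr (P n) (memoryless (W t)) x y \<le> \<theta> n}" for n t
  define dvg where "dvg n t = expect (joint (P n) (memoryless (V t)))
      (\<lambda>(x, z). log 2 (1 + lr (P n) (memoryless (V t)) x z / L n))" for n t
  define e where "e n = (\<Sum>t\<in>{1..T}. fail n t + real (2 * J n * L n * card {1..T}) / \<theta> n + dvg n t)" for n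
  have fP: "finite (set_pmf (P n))" for n
    unfolding P_def by (intro finite_set_replicate_pmf) simp
  have set_P: "set_pmf (P n) \<subseteq> words n" for n
    by (auto simp: P_def set_replicate_pmf)
  have fW: "finite (set_pmf (memoryless (W t) x))" for t x by (intro finite_set_memoryless) simp
  have fV: "finite (set_pmf (memoryless (V t) x))" for t x by (intro finite_set_memoryless) simp

  \<comment> \<open>Vanishing of the one-shot bound\<close>
  have "e \<longlonglongrightarrow> (\<Sum>t\<in>{1..T}. 0 + 0 + 0)"
    unfolding e_def
  proof (intro tendsto_sum tendsto_add)
    fix t assume t: "t \<in> {1..T}"
    from prob_lr_le_memoryless[OF _ _ m1[OF t]] obtain r where
      r: "0 \<le> r" "r < 1" "\<And>n. fail n t \<le> r ^ n"
      unfolding fail_def P_def \<theta>_def by force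
    show "(\<lambda>n. fail n t) \<longlonglongrightarrow> 0"
    proof (rule tendsto_sandwich[OF _ _ tendsto_const])
      show "(\<lambda>n. r ^ n) \<longlonglongrightarrow> 0" using r by (intro LIMSEQ_realpow_zero)
    qed (use r in \<open>auto simp: fail_def\<close>)
    from expect_log_lr_memoryless[OF _ _ m2[OF t]] L(1) obtain r K where
      r: "0 \<le> r" "r < 1" "\<And>n. dvg n t \<le> K * r ^ n"
      unfolding dvg_def P_def by force
    show "(\<lambda>n. dvg n t) \<longlonglongrightarrow> 0"
    proof (rule tendsto_sandwich[OF _ _ tendsto_const])
      show "(\<lambda>n. K * r ^ n) \<longlonglongrightarrow> 0"
        using r tendsto_mult_right_zero[OF LIMSEQ_realpow_zero] by blast
      show "\<forall>\<^sub>F n in sequentially. 0 \<le> dvg n t"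
        unfolding dvg_def
        by (auto intro!: always_eventually expect_nonneg zero_le_log_cancel_iff[THEN iffD2]
            simp: lr_nonneg add_pos_nonneg)
    qed (use r in auto)
    show "(\<lambda>n. real (2 * J n * L n * card {1..T}) / \<theta> n) \<longlonglongrightarrow> 0"
    proof (rule tendsto_sandwich[OF _ _ tendsto_const])
      \<comment> \<open>The 8 collects the doubled number of messages and the two roundings in
        \<open>J\<close> and \<open>L\<close>.\<close>
      show "(\<lambda>n. 8 * T * (2 powr (- \<delta>)) ^ n) \<longlonglongrightarrow> 0"
        using \<delta> by (intro tendsto_mult_right_zero LIMSEQ_realpow_zero) (auto simp: powr_less_one)
      have "real (2 * J n * L n * card {1..T}) / \<theta> n \<le> 8 * T * (2 powr (- \<delta>)) ^ n" for n
      proof -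
        have "real (J n) * real (L n) \<le> (2 * 2 powr (n * R)) * (2 * 2 powr (n * m2))"
          using J(2)[of n] L(2)[of n] by (intro mult_mono) auto
        then have "2 * T * (real (J n) * real (L n)) \<le>
            2 * T * ((2 * 2 powr (n * R)) * (2 * 2 powr (n * m2)))"
          by (intro mult_left_mono) auto
        also have "\<dots> = 8 * T * (2 powr (n * R) * 2 powr (n * m2))" by simp
        also have "2 * T * (real (J n) * real (L n)) = real (2 * J n * L n * card {1..T})" by simp
        finally have "real (2 * J n * L n * card {1..T}) / \<theta> n \<le>
            8 * T * (2 powr (n * R) * 2 powr (n * m2)) / \<theta> n"
          by (intro divide_right_mono) (auto simp: \<theta>_def)
        also have "\<dots> = 8 * T * 2 powr (n * (R + m2 - m1))"
          by (simp add: \<theta>_def powr_add powr_diff ring_distribs)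
        also have "\<dots> = 8 * T * (2 powr (- \<delta>)) ^ n"
          unfolding m by (simp add: powr_realpow[symmetric] powr_powr mult.commute)
        finally show ?thesis .
      qed
      then show "\<forall>\<^sub>F n in sequentially. real (2 * J n * L n * card {1..T}) / \<theta> n \<le>
          8 * T * (2 powr (- \<delta>)) ^ n" by simp
    qed (auto simp: \<theta>_def)
  qed
  then have "(\<lambda>n. 2 * e n) \<longlonglongrightarrow> 2 * 0" by (intro tendsto_mult_left) simp
  then have e: "(\<lambda>n. 2 * e n) \<longlonglongrightarrow> 0" by simp

  \<comment> \<open>The codes and their properties\<close>
  have "\<exists>E D. (\<forall>j\<in>{1..J n}. set_pmf (E j) \<subseteq> set_pmf (P n)) \<and> disjoint_family_on D {1..J n} \<and>
    (\<forall>t\<in>{1..T}. \<forall>j\<in>{1..J n}.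
       expect (E j) (\<lambda>x. measure_pmf.prob (memoryless (W t) x) (- D j)) \<le> 2 * e n \<and>
       kl (bind_pmf (E j) (memoryless (V t))) (bind_pmf (P n) (memoryless (V t))) \<le> 2 * e n)" for n
    unfolding e_def fail_def dvg_def
    by (rule one_shot_code) (use fP fW fV J L in \<open>auto simp: \<theta>_def\<close>)
  then obtain E D where
    E: "\<And>n j. j \<in> {1..J n} \<Longrightarrow> set_pmf (E n j) \<subseteq> set_pmf (P n)" and
    D: "\<And>n. disjoint_family_on (D n) {1..J n}" and
    err: "\<And>n t j. t \<in> {1..T} \<Longrightarrow> j \<in> {1..J n} \<Longrightarrow>
      expect (E n j) (\<lambda>x. measure_pmf.prob (memoryless (W t) x) (- D n j)) \<le> 2 * e n" and
    kl: "\<And>n t j. t \<in> {1..T} \<Longrightarrow> j \<in> {1..J n} \<Longrightarrow>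
      kl (bind_pmf (E n j) (memoryless (V t))) (bind_pmf (P n) (memoryless (V t))) \<le> 2 * e n"
    by metis
  define D' where "D' n j = D n j \<inter> words n" for n j
  have code: "is_code n (J n) (E n) (D' n)" for n
    using J(3)[of n] E[of _ n] set_P[of n] D[of n]
    unfolding is_code_def D'_def disjoint_family_on_def by fast
  have max_error: "max_error T W n (J n) (E n) (D' n) \<in> {0..2 * e n}" for n
    unfolding D'_def using T J(3) E set_P err by (intro max_error_bounds) blast+
  have max_leakage: "max_leakage T V (J n) (E n) \<in> {0..2 * e n}" for n
    using T J(3)
  \<comment> \<open>The reference is the output law of the i.i.d. input, the one for which the
    divergence was bounded.\<close>
  proof (rule max_leakage_bounds[where Q = "\<lambda>t. bind_pmf (P n) (memoryless (V t))"])
    fix t j assume tj: "t \<in> {1..T}" "j \<in> {1..J n}"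
    show "finite (set_pmf (bind_pmf (E n j) (memoryless (V t))))"
      using finite_subset[OF E[OF tj(2)] fP] fV by simp
    show "set_pmf (bind_pmf (E n j) (memoryless (V t))) \<subseteq> set_pmf (bind_pmf (P n) (memoryless (V t)))"
      using E[OF tj(2)] by auto
  qed (rule kl)
  have rate: "R \<le> log 2 (J n) / n" if "n \<ge> 1" for n
  proof -
    have "n * R = log 2 (2 powr (n * R))" by simp
    also have "\<dots> \<le> log 2 (J n)" using J(1)[of n] J(3)[of n] by (subst log_le_cancel_iff) auto
    finally show ?thesis using that by (simp add: field_simps)
  qed
  show ?thesis
    unfolding achievable_secrecy_rate_def
  proof (intro conjI exI)
    show "\<forall>n\<ge>1. is_code n (J n) (E n) (D' n)" using code by blast
    show "(\<lambda>n. max_error T W n (J n) (E n) (D' n)) \<longlonglongrightarrow> 0"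
      by (rule tendsto_sandwich[OF _ _ tendsto_const e]) (use max_error in auto)
    show "(\<lambda>n. max_leakage T V (J n) (E n)) \<longlonglongrightarrow> 0"
      by (rule tendsto_sandwich[OF _ _ tendsto_const e]) (use max_leakage in auto)
    show "ereal R \<le> liminf (\<lambda>n. ereal (log 2 (J n) / n))"
      using rate by (intro Liminf_bounded eventually_sequentiallyI[of 1]) simp
  qed (rule R(1))
qed

theorem theorem3p6:
  fixes T :: nat
    and W :: "nat \<Rightarrow> 'a::finite \<Rightarrow> 'b::finite pmf"
    and V :: "nat \<Rightarrow> 'a \<Rightarrow> 'c::finite pmf"
  assumes "T \<ge> 1"
  shows "\<exists>p. (\<forall>q. rate_difference T W V q \<le> rate_difference T W V p) \<and>
             secrecy_capacity T W V \<ge> ereal (rate_difference T W V p)"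
proof -
  obtain p where p: "\<forall>q. rate_difference T W V q \<le> rate_difference T W V p"
    using rate_difference_attains_max[OF assms] by blast
  have le: "ereal R \<le> secrecy_capacity T W V" if "achievable_secrecy_rate T W V R" for R
    unfolding secrecy_capacity_def using that by (intro SUP_upper) simp
  have "ereal (rate_difference T W V p) \<le> secrecy_capacity T W V"
  \<comment> \<open>It suffices to reach every value strictly below the difference. Achievable rates
    are nonnegative by definition, so values up to 0 are handled by rate 0.\<close>
  proof (rule dense_le)
    fix x assume x: "x < ereal (rate_difference T W V p)"
    show "x \<le> secrecy_capacity T W V"
    proof (cases "x \<le> 0")
      case True
      also have "0 \<le> secrecy_capacity T W V"
        using le[OF achievable_0[OF assms]] by (simp add: zero_ereal_def)
      finally show ?thesis .
    next
      case False
      with x obtain R where "x = ereal R" "0 \<le> R" "R < rate_difference T W V p"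
        by (cases x) auto
      with le achievable_below_rate_difference[OF assms] show ?thesis by blast
    qed
  qed
  with p show ?thesis by blast
qed

end
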